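(* Let $H$ be a complex Hilbert space with $\dim H>1$. Let $\phi: B_s(H)\to B_s(H)$ be a bijective map with the property that \[ A\leq B \Longleftrightarrow \phi(A)\leq \phi(B) \] holds whenever $A,B\in B_s(H)$. Then there exist an operator $X\in B_s(H)$ and an invertible bounded either linear or conjugate-linear operator $T:H \to H$ such that \[ \phi(A)=TAT^* +X\qquad \text{for all } A\in B_s(H). \]
   Context: $H$ is a complex Hilbert space (of arbitrary, possibly infinite, dimension). $B_s(H)$ denotes the set of all self-adjoint bounded linear operators on $H$. For $A,B\in B_s(H)$, $A\leq B$ means $\langle Ax,x\rangle\leq\langle Bx,x\rangle$ for every $x\in H$. No linearity or continuity of $\phi$ is assumed. For a bounded linear $T$, $T^*$ is the usual adjoint; for a bounded conjugate-linear $T$, $T^*$ is the bounded conjugate-linear operator determined by $\langle Tx,y\rangle=\langle T^*y,x\rangle$ for all $x,y\in H$ (so $TAT^*$ is a linear operator in both cases). *)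

theory Defs
  imports "HOL-Analysis.Analysis" "HOL-Library.Extended_Nat"
begin

(* The library provides real inner product spaces only.  A complex inner product space is
   one whose real inner product is the real part of a sesquilinear Hermitian form; hence norm
   and topology are the library's ones.  The complex inner product is linear in the first
   argument.  Definiteness and 1 *\<^sub>C x = x are inherited (lemmas below). *)
class complex_inner = real_inner +
  fixes scaleC :: "complex \<Rightarrow> 'a \<Rightarrow> 'a" (infixr "*\<^sub>C" 75)
    and cinner :: "'a \<Rightarrow> 'a \<Rightarrow> complex"
  assumes scaleC_add_right: "c *\<^sub>C (x + y) = c *\<^sub>C x + c *\<^sub>C y"
    and scaleC_add_left: "(c + d) *\<^sub>C x = c *\<^sub>C x + d *\<^sub>C x"
    and scaleC_scaleC: "c *\<^sub>C d *\<^sub>C x = (c * d) *\<^sub>C x"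
    and scaleR_scaleC: "r *\<^sub>R x = complex_of_real r *\<^sub>C x"
    and cinner_commute: "cinner x y = cnj (cinner y x)"
    and cinner_add_left: "cinner (x + y) z = cinner x z + cinner y z"
    and cinner_scaleC_left: "cinner (c *\<^sub>C x) y = c * cinner x y"
    and inner_eq_Re_cinner: "inner x y = Re (cinner x y)"

class complex_hilbert = complex_inner + complete_space

lemma scaleC_one: "1 *\<^sub>C x = (x :: 'a :: complex_inner)"
  using scaleR_scaleC[of 1 x] by simp

lemma cinner_self: "cinner x x = complex_of_real ((norm x)\<^sup>2)"
  for x :: "'a :: complex_inner"
proof (rule complex_eqI)
  show "Re (cinner x x) = Re (complex_of_real ((norm x)\<^sup>2))"
    by (simp add: inner_eq_Re_cinner[symmetric] power2_norm_eq_inner)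
  have "Im (cinner x x) = - Im (cinner x x)"
    using arg_cong[OF cinner_commute[of x x], of Im] by (simp only: cnj.sel(2))
  then show "Im (cinner x x) = Im (complex_of_real ((norm x)\<^sup>2))"
    by simp
qed

global_interpretation complex_vector:
  vector_space "scaleC :: complex \<Rightarrow> 'a \<Rightarrow> 'a :: complex_inner"
  by unfold_locales
    (simp_all add: scaleC_add_right scaleC_add_left scaleC_scaleC scaleC_one)

(* The library's dim is 0 for spaces without a finite basis. *)
definition cdim :: "'a :: complex_inner itself \<Rightarrow> enat" where
  "cdim _ = (if \<exists>B :: 'a set. finite B \<and> complex_vector.span B = UNIV
             then enat (complex_vector.dim (UNIV :: 'a set)) else \<infinity>)"

definition bounded_clinear :: "('a :: complex_inner \<Rightarrow> 'a) \<Rightarrow> bool" where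
  "bounded_clinear T \<longleftrightarrow> bounded_linear T \<and> (\<forall>c x. T (c *\<^sub>C x) = c *\<^sub>C T x)"

definition bounded_antilinear :: "('a :: complex_inner \<Rightarrow> 'a) \<Rightarrow> bool" where
  "bounded_antilinear T \<longleftrightarrow> bounded_linear T \<and> (\<forall>c x. T (c *\<^sub>C x) = cnj c *\<^sub>C T x)"

definition cadjoint :: "('a :: complex_inner \<Rightarrow> 'a) \<Rightarrow> ('a \<Rightarrow> 'a)" where
  "cadjoint T = (THE S. bounded_clinear S \<and> (\<forall>x y. cinner (T x) y = cinner x (S y)))"

definition antilinear_adjoint :: "('a :: complex_inner \<Rightarrow> 'a) \<Rightarrow> ('a \<Rightarrow> 'a)" where
  "antilinear_adjoint T =
     (THE S. bounded_antilinear S \<and> (\<forall>x y. cinner (T x) y = cinner (S y) x))"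

definition selfadjoint_ops :: "('a :: complex_inner \<Rightarrow> 'a) set" where
  "selfadjoint_ops = {A. bounded_clinear A \<and> cadjoint A = A}"

(* Only used for self-adjoint operators, whose quadratic form is real-valued. *)
definition op_le :: "('a :: complex_inner \<Rightarrow> 'a) \<Rightarrow> ('a \<Rightarrow> 'a) \<Rightarrow> bool" where
  "op_le A B \<longleftrightarrow> (\<forall>x. Re (cinner (A x) x) \<le> Re (cinner (B x) x))"

(* Used for bounded linear or antilinear T; complex (anti)linearity of the inverse is
   automatic. *)
definition invertible_op :: "('a :: complex_inner \<Rightarrow> 'a) \<Rightarrow> bool" where
  "invertible_op T \<longleftrightarrow> bij T \<and> bounded_linear (inv T)"

end

theory Submission
  imports Defs
begin

text \<open>
The proof recovers the linear structure from the order, starting with operators of rank one.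
Write \<open>dyad x\<close> for the operator \<open>u \<mapsto> \<langle>u, x\<rangle> x\<close>, and \<open>\<preceq>\<close> for the order of quadratic forms.

A positive operator is a dyad precisely if the interval below it is a chain
(\<open>dyad_interval_chain_iff\<close>). Hence \<open>\<phi>\<close> maps each line \<open>A + t *\<^sub>R dyad x\<close> onto a line of the same kind,
by a monotone change of the parameter (\<open>line_onto_line\<close>). Two such lines whose
difference is a dyad of another direction are ordered parameter by parameter, and this alone forces
their images to be parallel and to be parametrised in the same way (\<open>dyad_increment_off_line\<close>);
this is the situation of the theorem of Alexandrov and Zeeman, by which the causal automorphisms of
Minkowski space are affine. In dimension at least two the increments of \<open>\<phi>\<close> along lines are
therefore independent of translations by operators of finite rank. They are then additive in the
parameter, and linear by monotonicity. If \<open>\<phi> 0 = 0\<close>, it follows that \<open>\<phi>\<close> is real linear on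
the self-adjoint operators of finite rank.

For each \<open>x\<close> the image of \<open>dyad x\<close> is \<open>dyad a\<close> with \<open>a\<close> unique up to a phase. A reference vector
\<open>e\<close> and the polarisations \<open>cross x e = dyad (x + e) - dyad x - dyad e\<close> fix the phases: an explicit
formula yields two real linear candidates for \<open>T\<close>, one complex linear and one conjugate-linear, and
one of them satisfies \<open>\<phi> (dyad x) = dyad (T x)\<close> for all \<open>x\<close> (\<open>lift_exists\<close>).

A positive operator is determined by the dyads below it (\<open>positive_le_if_dyads_le\<close>), so
\<open>\<phi> A = T A T\<^sup>*\<close> for all positive \<open>A\<close> (\<open>congruence_on_positive\<close>). Applied to the maps
\<open>C \<mapsto> \<phi> (B + C) - \<phi> B\<close>, this extends to all self-adjoint operators (\<open>affine_form\<close>).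
\<close>

section \<open>The complex inner product\<close>

lemma cinner_add_right: "cinner x (y + z) = cinner x y + cinner x z"
  for x :: "'a :: complex_inner"
  by (metis cinner_add_left cinner_commute complex_cnj_add)

lemma cinner_scaleC_right: "cinner x (c *\<^sub>C y) = cnj c * cinner x y"
  for x :: "'a :: complex_inner"
  by (metis cinner_commute cinner_scaleC_left complex_cnj_mult)

lemma cinner_scaleR_left: "cinner (r *\<^sub>R x) y = of_real r * cinner x y"
  for x :: "'a :: complex_inner"
  by (simp add: scaleR_scaleC cinner_scaleC_left)

lemma cinner_scaleR_right: "cinner x (r *\<^sub>R y) = of_real r * cinner x y"
  for x :: "'a :: complex_inner"
  by (simp add: scaleR_scaleC cinner_scaleC_right)

lemma cinner_zero_left [simp]: "cinner 0 y = 0" for y :: "'a :: complex_inner"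
  using cinner_scaleR_left[of 0 0 y] by simp

lemma cinner_zero_right [simp]: "cinner y 0 = 0" for y :: "'a :: complex_inner"
  using cinner_scaleR_right[of y 0 0] by simp

lemma cinner_minus_left: "cinner (- x) y = - cinner x y" for x :: "'a :: complex_inner"
  using cinner_scaleR_left[of "-1" x y] by simp

lemma cinner_minus_right: "cinner x (- y) = - cinner x y" for x :: "'a :: complex_inner"
  using cinner_scaleR_right[of x "-1" y] by simp

lemma cinner_diff_left: "cinner (x - y) z = cinner x z - cinner y z"
  for x :: "'a :: complex_inner"
  using cinner_add_left[of x "- y" z] by (simp add: cinner_minus_left)

lemma cinner_diff_right: "cinner z (x - y) = cinner z x - cinner z y"
  for x :: "'a :: complex_inner"
  using cinner_add_right[of z x "- y"] by (simp add: cinner_minus_right)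

lemmas cinner_simps = cinner_add_left cinner_add_right cinner_diff_left cinner_diff_right
  cinner_minus_left cinner_minus_right cinner_scaleC_left cinner_scaleC_right
  cinner_scaleR_left cinner_scaleR_right

lemma cinner_self_eq_0 [simp]: "cinner x x = 0 \<longleftrightarrow> x = 0" for x :: "'a :: complex_inner"
  by (simp add: cinner_self)

lemma cmod_cinner_commute: "cmod (cinner x y) = cmod (cinner y x)" for x :: "'a :: complex_inner"
  by (metis cinner_commute complex_mod_cnj)

lemma Im_cinner: "Im (cinner x y) = inner x (\<i> *\<^sub>C y)" for x :: "'a :: complex_inner"
  by (simp add: inner_eq_Re_cinner cinner_scaleC_right)

lemma inner_i_left: "inner (\<i> *\<^sub>C x) y = - inner x (\<i> *\<^sub>C y)" for x :: "'a :: complex_inner"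
  by (simp add: inner_eq_Re_cinner cinner_simps)

lemma norm_scaleC: "norm (c *\<^sub>C x) = cmod c * norm x" for x :: "'a :: complex_inner"
proof -
  have "complex_of_real ((norm (c *\<^sub>C x))\<^sup>2) = c * cnj c * complex_of_real ((norm x)\<^sup>2)"
    by (simp only: cinner_self[symmetric] cinner_scaleC_left cinner_scaleC_right mult_ac)
  also have "\<dots> = complex_of_real ((cmod c * norm x)\<^sup>2)"
    by (simp add: complex_norm_square[symmetric] power_mult_distrib flip: of_real_power)
  finally show ?thesis
    by (simp only: of_real_eq_iff power2_eq_iff_nonneg norm_ge_zero mult_nonneg_nonneg)
qed

lemma scaleC_commute: "c *\<^sub>C d *\<^sub>C x = d *\<^sub>C c *\<^sub>C x" for x :: "'a :: complex_inner"
  by (simp add: scaleC_scaleC mult.commute)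

lemma scaleC_scaleR: "c *\<^sub>C r *\<^sub>R x = r *\<^sub>R c *\<^sub>C x" for x :: "'a :: complex_inner"
  by (simp add: scaleR_scaleC scaleC_commute)

text \<open>Rotating a vector by such a phase turns the modulus of a complex inner product into a
real inner product, to which the facts on real inner product spaces apply.\<close>

lemma unimodular_phase: "\<exists>c. cmod c = 1 \<and> c * z = of_real (cmod z)"
proof (cases "z = 0")
  case False
  then show ?thesis
    by (intro exI[of _ "cnj z / of_real (cmod z)"])
      (simp add: norm_divide complex_norm_square[symmetric] mult.commute power2_eq_square field_simps)
qed (auto intro: exI[of _ 1])

lemma cmod_cinner_le: "cmod (cinner x y) \<le> norm x * norm y" for x :: "'a :: complex_inner"
proof -
  obtain c where c: "cmod c = 1" "c * cinner x y = of_real (cmod (cinner x y))"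
    using unimodular_phase by blast
  have "cmod (cinner x y) = inner (c *\<^sub>C x) y"
    by (simp add: inner_eq_Re_cinner cinner_scaleC_left c)
  also have "\<dots> \<le> norm (c *\<^sub>C x) * norm y" by (rule norm_cauchy_schwarz)
  finally show ?thesis by (simp add: norm_scaleC c)
qed

lemma cinner_eqI: "(\<And>u. cinner x u = cinner y u) \<Longrightarrow> x = y" for x :: "'a :: complex_inner"
  by (metis cinner_diff_left cinner_self_eq_0 eq_iff_diff_eq_0)

section \<open>Riesz representation and adjoints\<close>

text \<open>The representing vector is the minimiser of \<open>J x = \<parallel>x\<parallel>\<^sup>2 - 2 * l x\<close>. Boundedness of \<open>l\<close>
bounds \<open>J\<close> from below, and the parallelogram law makes every minimising sequence Cauchy, so
completeness yields the minimiser; that \<open>J\<close> does not decrease along any line through it is the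
equation \<open>l x = \<langle>x, v\<rangle>\<close>.\<close>

lemma riesz_representation:
  fixes l :: "'a :: {real_inner, complete_space} \<Rightarrow> real"
  assumes "bounded_linear l"
  shows "\<exists>v. \<forall>x. l x = inner x v"
proof -
  interpret l: bounded_linear l by fact
  define J where "J x = inner x x - 2 * l x" for x
  obtain K where K: "\<And>x. \<bar>l x\<bar> \<le> norm x * K" and "K \<ge> 0"
    using l.nonneg_bounded by (auto simp: mult.commute)
  have J_lower: "J x \<ge> - K\<^sup>2" for x
  proof -
    have "0 \<le> (norm x - K)\<^sup>2" by simp
    then show ?thesis using K[of x]
      by (auto simp: J_def power2_norm_eq_inner[symmetric] power2_diff abs_le_iff)
  qed
  define m where "m = Inf (range J)"
  have bdd: "bdd_below (range J)" using J_lower by (auto intro!: bdd_belowI)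
  have m_le: "m \<le> J x" for x unfolding m_def using bdd by (simp add: cINF_lower)
  have "\<exists>x. J x < m + 1 / Suc n" for n
  proof -
    have "Inf (range J) < m + 1 / Suc n" by (simp add: m_def)
    then show ?thesis using cInf_lessD[of "range J"] by auto
  qed
  then obtain X where X: "\<And>n. J (X n) < m + 1 / Suc n" by metis
  (* the parallelogram law, with m as a lower bound at the midpoint *)
  have para: "(norm (x - y))\<^sup>2 \<le> 2 * (J x - m) + 2 * (J y - m)" for x y
  proof -
    have "(norm (x - y))\<^sup>2 = 2 * J x + 2 * J y - 4 * J ((1/2) *\<^sub>R (x + y))"
      by (simp add: J_def power2_norm_eq_inner l.diff l.add l.scaleR inner_simps inner_commute
          algebra_simps)
    with m_le[of "(1/2) *\<^sub>R (x + y)"] show ?thesis by simp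
  qed
  have "Cauchy X"
  proof (rule metric_CauchyI)
    fix e :: real assume "e > 0"
    then obtain N :: nat where N: "4 / e\<^sup>2 < real N" using reals_Archimedean2 by blast
    have "dist (X i) (X j) < e" if "i \<ge> N" "j \<ge> N" for i j
    proof -
      have "(norm (X i - X j))\<^sup>2 < 2 * (1 / Suc i) + 2 * (1 / Suc j)"
        using para[of "X i" "X j"] X[of i] X[of j] by argo
      also have "\<dots> \<le> 2 * (1 / Suc N) + 2 * (1 / Suc N)"
        using that by (intro add_mono mult_left_mono divide_left_mono) auto
      also have "\<dots> = 4 / real (Suc N)" by simp
      also have "\<dots> < e\<^sup>2"
      proof -
        have "4 < real N * e\<^sup>2" using N \<open>e > 0\<close> by (simp add: divide_less_eq)
        also have "\<dots> \<le> real (Suc N) * e\<^sup>2" by (intro mult_right_mono) auto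
        finally show ?thesis by (simp add: divide_less_eq mult.commute)
      qed
      finally show ?thesis using \<open>e > 0\<close> by (simp add: dist_norm power2_less_imp_less)
    qed
    then show "\<exists>M. \<forall>i\<ge>M. \<forall>j\<ge>M. dist (X i) (X j) < e" by blast
  qed
  then obtain v where v: "X \<longlonglongrightarrow> v" using Cauchy_convergent convergent_def by blast
  have "(\<lambda>n. J (X n)) \<longlonglongrightarrow> J v"
    unfolding J_def by (intro tendsto_intros v l.tendsto)
  moreover have "(\<lambda>n. m + 1 / Suc n) \<longlonglongrightarrow> m + 0"
    by (intro tendsto_intros LIMSEQ_inverse_real_of_nat[unfolded inverse_eq_divide])
  ultimately have "J v \<le> m"
    using X by (intro LIMSEQ_le[of "\<lambda>n. J (X n)" "J v" "\<lambda>n. m + 1 / Suc n"]) (auto intro: less_imp_le)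
  then have v_min: "J v \<le> J x" for x using m_le[of x] by linarith
  have "l x = inner x v" for x
  proof (cases "x = 0")
    case False
    define d where "d = inner x v - l x"
    have pos: "inner x x > 0" using False by simp
    have "J (v - (d / inner x x) *\<^sub>R x) = J v - d\<^sup>2 / inner x x"
      using pos by (simp add: J_def d_def l.diff l.scaleR inner_simps inner_commute field_simps
          power2_eq_square)
    then have "d\<^sup>2 / inner x x \<le> 0" using v_min[of "v - (d / inner x x) *\<^sub>R x"] by simp
    then have "d = 0" using pos by (simp add: divide_le_0_iff)
    then show ?thesis by (simp add: d_def)
  qed simp
  then show ?thesis by blast
qed

lemma bounded_linear_adjoint_exists:
  fixes T :: "'a :: {real_inner, complete_space} \<Rightarrow> 'a"
  assumes "bounded_linear T"
  shows "\<exists>S. bounded_linear S \<and> (\<forall>x y. inner (T x) y = inner x (S y))"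
proof -
  interpret T: bounded_linear T by fact
  have "\<exists>v. \<forall>x. inner (T x) y = inner x v" for y
    by (rule riesz_representation)
      (rule bounded_linear_compose[OF bounded_linear_inner_left assms])
  then obtain S where S: "\<And>x y. inner (T x) y = inner x (S y)" by metis
  obtain K where K: "\<And>x. norm (T x) \<le> norm x * K" and "K \<ge> 0"
    using T.nonneg_bounded by blast
  have "bounded_linear S"
  proof (rule bounded_linear_intro[where K = K])
    show "S (x + y) = S x + S y" for x y
      by (rule vector_eq_rdot[THEN iffD1]) (auto simp: inner_simps inner_commute S[symmetric])
    show "S (r *\<^sub>R x) = r *\<^sub>R S x" for r x
      by (rule vector_eq_rdot[THEN iffD1]) (auto simp: inner_simps inner_commute S[symmetric])
    show "norm (S y) \<le> norm y * K" for y
    proof -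
      have "norm (S y) * norm (S y) = inner (T (S y)) y"
        by (simp add: S flip: power2_norm_eq_inner power2_eq_square)
      also have "\<dots> \<le> norm (T (S y)) * norm y" by (rule norm_cauchy_schwarz)
      also have "\<dots> \<le> norm (S y) * K * norm y" by (intro mult_right_mono K) auto
      finally have "norm (S y) * norm (S y) \<le> norm (S y) * (norm y * K)" by (simp add: ac_simps)
      then show ?thesis using \<open>K \<ge> 0\<close> by (cases "norm (S y) = 0") auto
    qed
  qed
  with S show ?thesis by blast
qed

text \<open>The imaginary part of \<open>\<langle>x, y\<rangle>\<close> is the real inner product of \<open>x\<close> and \<open>\<i> y\<close>, so for an operator that
is linear or conjugate-linear the adjoint with respect to the real inner product already
satisfies the complex identity. Hence one construction of the adjoint serves both cases.\<close>

lemma clinear_adjoint_cinner: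
  fixes T :: "'a :: complex_inner \<Rightarrow> 'a"
  assumes T: "\<And>c x. T (c *\<^sub>C x) = c *\<^sub>C T x"
    and adj: "\<And>x y. inner (T x) y = inner x (S y)"
  shows "cinner (T x) y = cinner x (S y)"
proof (rule complex_eqI)
  show "Re (cinner (T x) y) = Re (cinner x (S y))"
    using adj by (simp add: inner_eq_Re_cinner)
  have "Im (cinner (T x) y) = - inner (T (\<i> *\<^sub>C x)) y"
    by (simp add: Im_cinner T inner_i_left)
  also have "\<dots> = Im (cinner x (S y))"
    by (simp add: adj Im_cinner inner_i_left)
  finally show "Im (cinner (T x) y) = Im (cinner x (S y))" .
qed

lemma antilinear_adjoint_cinner:
  fixes T :: "'a :: complex_inner \<Rightarrow> 'a"
  assumes T: "\<And>c x. T (c *\<^sub>C x) = cnj c *\<^sub>C T x"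
    and adj: "\<And>x y. inner (T x) y = inner x (S y)"
  shows "cinner (T x) y = cinner (S y) x"
proof (rule complex_eqI)
  show "Re (cinner (T x) y) = Re (cinner (S y) x)"
    using adj by (metis inner_eq_Re_cinner inner_commute)
  have "T (\<i> *\<^sub>C x) = - (\<i> *\<^sub>C T x)"
    using T[of \<i> x] by (simp add: complex_vector.scale_minus_left)
  then have "Im (cinner (T x) y) = inner (T (\<i> *\<^sub>C x)) y"
    by (simp add: Im_cinner inner_i_left)
  also have "\<dots> = inner (S y) (\<i> *\<^sub>C x)"
    by (metis adj inner_commute)
  finally show "Im (cinner (T x) y) = Im (cinner (S y) x)" by (simp add: Im_cinner)
qed

lemma cadjoint_eq:
  fixes T :: "'a :: complex_inner \<Rightarrow> 'a"
  assumes T: "bounded_clinear T" and S: "bounded_linear S"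
    and adj: "\<And>x y. inner (T x) y = inner x (S y)"
  shows "bounded_clinear S" "cadjoint T = S"
proof -
  have hom: "cinner (T x) y = cinner x (S y)" for x y
    using T adj by (intro clinear_adjoint_cinner) (auto simp: bounded_clinear_def)
  have "S (c *\<^sub>C x) = c *\<^sub>C S x" for c x
  proof (rule cinner_eqI)
    show "cinner (S (c *\<^sub>C x)) u = cinner (c *\<^sub>C S x) u" for u
      by (metis (no_types) cinner_commute cinner_scaleC_right hom)
  qed
  then show clin: "bounded_clinear S" using S by (simp add: bounded_clinear_def)
  show "cadjoint T = S" unfolding cadjoint_def
  proof (rule the_equality)
    fix R assume R: "bounded_clinear R \<and> (\<forall>x y. cinner (T x) y = cinner x (R y))"
    show "R = S"
    proof
      show "R y = S y" for y
        by (rule cinner_eqI) (metis R cinner_commute hom)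
    qed
  qed (use clin hom in blast)
qed

lemma antilinear_adjoint_eq:
  fixes T :: "'a :: complex_inner \<Rightarrow> 'a"
  assumes T: "bounded_antilinear T" and S: "bounded_linear S"
    and adj: "\<And>x y. inner (T x) y = inner x (S y)"
  shows "bounded_antilinear S" "antilinear_adjoint T = S"
proof -
  have hom: "cinner (T x) y = cinner (S y) x" for x y
    using T adj by (intro antilinear_adjoint_cinner) (auto simp: bounded_antilinear_def)
  have "S (c *\<^sub>C x) = cnj c *\<^sub>C S x" for c x
  proof (rule cinner_eqI)
    show "cinner (S (c *\<^sub>C x)) u = cinner (cnj c *\<^sub>C S x) u" for u
      by (simp add: hom[symmetric] cinner_scaleC_right cinner_scaleC_left)
  qed
  then show clin: "bounded_antilinear S" using S by (simp add: bounded_antilinear_def)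
  show "antilinear_adjoint T = S" unfolding antilinear_adjoint_def
  proof (rule the_equality)
    fix R assume R: "bounded_antilinear R \<and> (\<forall>x y. cinner (T x) y = cinner (R y) x)"
    show "R = S"
    proof
      show "R y = S y" for y
        by (rule cinner_eqI) (metis R hom)
    qed
  qed (use clin hom in blast)
qed

section \<open>Self-adjoint operators as bounded linear functions\<close>

definition hermitian :: "('a :: complex_inner \<Rightarrow>\<^sub>L 'a) set" where
  "hermitian = {A :: 'a \<Rightarrow>\<^sub>L 'a. \<forall>x y. cinner (A x) y = cinner x (A y)}"

lemma hermitian_cinner: "A \<in> hermitian \<Longrightarrow> cinner (A x) y = cinner x (A y)"
  by (simp add: hermitian_def)

lemma hermitian_inner: "A \<in> hermitian \<Longrightarrow> inner (A x) y = inner x (A y)"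
  by (simp add: inner_eq_Re_cinner hermitian_cinner)

lemma hermitian_scaleC: "A \<in> hermitian \<Longrightarrow> A (c *\<^sub>C x) = c *\<^sub>C A x"
  by (rule cinner_eqI) (simp add: hermitian_cinner cinner_scaleC_left)

lemma hermitian_0 [simp]: "0 \<in> hermitian"
  and hermitian_id [simp]: "id_blinfun \<in> hermitian"
  and hermitian_add [simp]: "A \<in> hermitian \<Longrightarrow> B \<in> hermitian \<Longrightarrow> A + B \<in> hermitian"
  and hermitian_diff [simp]: "A \<in> hermitian \<Longrightarrow> B \<in> hermitian \<Longrightarrow> A - B \<in> hermitian"
  and hermitian_scaleR [simp]: "A \<in> hermitian \<Longrightarrow> r *\<^sub>R A \<in> hermitian"
  by (simp_all add: hermitian_def blinfun.bilinear_simps cinner_simps)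

lemma subspace_hermitian: "subspace hermitian"
  by (auto simp: subspace_def)

text \<open>An adjoint defined by a definite description satisfies its defining identity only if such an
operator exists; this is where completeness is essential. It makes self-adjointness the same
as symmetry, so that the problem can be treated inside the real normed vector space of
bounded linear functions.\<close>

lemma selfadjoint_ops_iff:
  "f \<in> selfadjoint_ops \<longleftrightarrow> (\<exists>A \<in> hermitian. f = blinfun_apply A)"
  for f :: "'a :: complex_hilbert \<Rightarrow> 'a"
proof
  assume f: "f \<in> selfadjoint_ops"
  then have cl: "bounded_clinear f" and eq: "cadjoint f = f"
    by (auto simp: selfadjoint_ops_def)
  then have bl: "bounded_linear f" by (simp add: bounded_clinear_def)
  obtain S where S: "bounded_linear S" "\<And>x y. inner (f x) y = inner x (S y)"
    using bounded_linear_adjoint_exists[OF bl] by blast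
  have "S = f" using cadjoint_eq(2)[OF cl S] eq by simp
  then have "cinner (f x) y = cinner x (f y)" for x y
    using clinear_adjoint_cinner[of f S] cl S(2) by (simp add: bounded_clinear_def)
  then have "Blinfun f \<in> hermitian" and "f = blinfun_apply (Blinfun f)"
    using bl by (simp_all add: hermitian_def bounded_linear_Blinfun_apply)
  then show "\<exists>A \<in> hermitian. f = blinfun_apply A" by blast
next
  assume "\<exists>A \<in> hermitian. f = blinfun_apply A"
  then obtain A where A: "A \<in> hermitian" "f = blinfun_apply A" by blast
  have "bounded_clinear f"
    using A by (simp add: bounded_clinear_def hermitian_scaleC blinfun.bounded_linear_right)
  moreover from cadjoint_eq(2)[OF this, of f] have "cadjoint f = f"
    using A by (simp add: hermitian_inner blinfun.bounded_linear_right)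
  ultimately show "f \<in> selfadjoint_ops" by (simp add: selfadjoint_ops_def)
qed

section \<open>The order of quadratic forms\<close>

definition qle :: "('a :: complex_inner \<Rightarrow>\<^sub>L 'a) \<Rightarrow> ('a \<Rightarrow>\<^sub>L 'a) \<Rightarrow> bool" (infix "\<preceq>" 50) where
  "A \<preceq> B \<longleftrightarrow> (\<forall>x. inner (A x) x \<le> inner (B x) x)"

lemma op_le_iff_qle: "op_le (blinfun_apply A) (blinfun_apply B) \<longleftrightarrow> A \<preceq> B"
  by (simp add: op_le_def qle_def inner_eq_Re_cinner)

lemma qle_refl [simp]: "A \<preceq> A" by (simp add: qle_def)

lemma qle_trans: "A \<preceq> B \<Longrightarrow> B \<preceq> C \<Longrightarrow> A \<preceq> C"
  unfolding qle_def using order_trans by blast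

lemma qle_diff_iff: "0 \<preceq> B - A \<longleftrightarrow> A \<preceq> B"
  by (simp add: qle_def blinfun.bilinear_simps inner_simps)

lemma qle_add_left_iff [simp]: "C + A \<preceq> C + B \<longleftrightarrow> A \<preceq> B"
  by (simp add: qle_def blinfun.bilinear_simps inner_simps)

lemma qle_diff_right_iff [simp]: "A - C \<preceq> B - C \<longleftrightarrow> A \<preceq> B"
  and qle_add_same1 [simp]: "A \<preceq> A + C \<longleftrightarrow> 0 \<preceq> C"
  and qle_add_same2 [simp]: "A \<preceq> C + A \<longleftrightarrow> 0 \<preceq> C"
  and qle_add_same3 [simp]: "A + C \<preceq> A \<longleftrightarrow> C \<preceq> 0"
  by (simp_all add: qle_def blinfun.bilinear_simps inner_simps)

lemma qle_diff_le_iff: "A - B \<preceq> C \<longleftrightarrow> A \<preceq> B + C"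
  by (simp add: qle_def blinfun.bilinear_simps inner_simps algebra_simps)

text \<open>The quadratic polynomial \<open>t \<mapsto> \<langle>M (x + t y), x + t y\<rangle>\<close> is nonnegative, so its discriminant is not
positive.\<close>

lemma positive_cauchy_schwarz_inner:
  assumes M: "M \<in> hermitian" "0 \<preceq> M"
  shows "(inner (M x) y)\<^sup>2 \<le> inner (M x) x * inner (M y) y"
proof -
  have quad: "0 \<le> inner (M x) x + 2 * t * inner (M x) y + t\<^sup>2 * inner (M y) y" for t
  proof -
    have "0 \<le> inner (M (x + t *\<^sub>R y)) (x + t *\<^sub>R y)" using M(2) by (simp add: qle_def)
    also have "inner (M y) x = inner (M x) y" using M(1) by (metis hermitian_inner inner_commute)
    then have "inner (M (x + t *\<^sub>R y)) (x + t *\<^sub>R y)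
        = inner (M x) x + 2 * t * inner (M x) y + t\<^sup>2 * inner (M y) y"
      by (simp add: blinfun.bilinear_simps inner_simps power2_eq_square algebra_simps)
    finally show ?thesis .
  qed
  show ?thesis
  proof (cases "inner (M y) y = 0")
    case True
    have "inner (M x) y = 0"
    proof (rule ccontr)
      assume "inner (M x) y \<noteq> 0"
      then show False
        using quad[of "- (inner (M x) x + 1) / (2 * inner (M x) y)"] True
        by (simp add: diff_divide_distrib left_diff_distrib)
    qed
    then show ?thesis using True by simp
  next
    case False
    then have pos: "inner (M y) y > 0" using M(2) by (simp add: qle_def less_le)
    have "0 \<le> inner (M x) x - (inner (M x) y)\<^sup>2 / inner (M y) y"
      using quad[of "- inner (M x) y / inner (M y) y"] pos
      by (simp add: power2_eq_square field_simps)
    then show ?thesis using pos by (simp add: field_simps)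
  qed
qed

lemma positive_cauchy_schwarz:
  assumes M: "M \<in> hermitian" "0 \<preceq> M"
  shows "(cmod (cinner (M x) y))\<^sup>2 \<le> inner (M x) x * inner (M y) y"
proof -
  obtain c where c: "cmod c = 1" "c * cinner (M x) y = of_real (cmod (cinner (M x) y))"
    using unimodular_phase by blast
  have "cmod (cinner (M x) y) = inner (M (c *\<^sub>C x)) y"
    using M by (simp add: inner_eq_Re_cinner cinner_scaleC_left c hermitian_scaleC)
  moreover have "inner (M (c *\<^sub>C x)) (c *\<^sub>C x) = inner (M x) x"
  proof -
    have "c * cnj c = 1" using c by (simp add: complex_norm_square[symmetric])
    then have "cnj c * (c * z) = z" for z by (simp add: mult.commute flip: mult.assoc)
    then show ?thesis using M(1)
      by (simp only: inner_eq_Re_cinner cinner_scaleC_left cinner_scaleC_right hermitian_scaleC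
          mult.left_commute[of c])
  qed
  ultimately show ?thesis using positive_cauchy_schwarz_inner[OF M, of "c *\<^sub>C x" y] by simp
qed

lemma positive_form_eq_0:
  assumes M: "M \<in> hermitian" "0 \<preceq> M" and "inner (M x) x = 0"
  shows "M x = 0"
  using positive_cauchy_schwarz_inner[OF M, of x "M x"] assms(3) by simp

lemma qle_antisym:
  assumes "A \<in> hermitian" "B \<in> hermitian" "A \<preceq> B" "B \<preceq> A"
  shows "A = B"
proof (rule blinfun_eqI)
  fix x
  have "(B - A) x = 0"
    using assms by (intro positive_form_eq_0 hermitian_diff)
      (auto simp: qle_diff_iff qle_def blinfun.bilinear_simps inner_simps intro: antisym)
  then show "A x = B x" by (simp add: blinfun.bilinear_simps)
qed

section \<open>Operators of rank one\<close>

definition dyad :: "'a :: complex_inner \<Rightarrow> ('a \<Rightarrow>\<^sub>L 'a)" where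
  "dyad x = Blinfun (\<lambda>u. cinner u x *\<^sub>C x)"

lemma dyad_apply: "dyad x u = cinner u x *\<^sub>C x"
proof -
  have "bounded_linear (\<lambda>u. cinner u x *\<^sub>C x)"
  proof (rule bounded_linear_intro[where K = "norm x * norm x"])
    show "norm (cinner u x *\<^sub>C x) \<le> norm u * (norm x * norm x)" for u
      using mult_right_mono[OF cmod_cinner_le[of u x], of "norm x"]
      by (simp add: norm_scaleC mult.assoc)
  qed (simp_all add: cinner_simps scaleC_add_left scaleR_scaleC scaleC_scaleC)
  then show ?thesis by (simp add: dyad_def bounded_linear_Blinfun_apply)
qed

lemma dyad_form: "inner (dyad x u) u = (cmod (cinner u x))\<^sup>2"
  by (simp add: inner_eq_Re_cinner dyad_apply cinner_simps cinner_commute[of x u]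
      complex_norm_square[symmetric] flip: of_real_power)

lemma hermitian_dyad [simp]: "dyad x \<in> hermitian"
  by (simp add: hermitian_def dyad_apply cinner_simps cinner_commute[of x])

lemma dyad_nonneg [simp]: "0 \<preceq> dyad x"
  by (simp add: qle_def dyad_form)

lemma dyad_scaleC: "dyad (c *\<^sub>C x) = (cmod c)\<^sup>2 *\<^sub>R dyad x"
proof (rule blinfun_eqI)
  have "cnj c * c = of_real ((cmod c)\<^sup>2)" by (simp only: complex_norm_square mult.commute)
  then show "dyad (c *\<^sub>C x) u = ((cmod c)\<^sup>2 *\<^sub>R dyad x) u" for u
    by (simp add: dyad_apply cinner_simps scaleR_scaleC scaleC_scaleC blinfun.scaleR_left mult_ac)
qed

lemma dyad_sqrt: "r \<ge> 0 \<Longrightarrow> dyad (of_real (sqrt r) *\<^sub>C x) = r *\<^sub>R dyad x"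
  by (simp add: dyad_scaleC)

lemma dyad_0 [simp]: "dyad 0 = 0"
  by (rule blinfun_eqI) (simp add: dyad_apply)

lemma dyad_eq_0 [simp]: "dyad x = 0 \<longleftrightarrow> x = 0"
proof
  assume "dyad x = 0"
  then show "x = 0" using dyad_form[of x x] by simp
qed simp

abbreviation cline :: "'a :: complex_inner \<Rightarrow> 'a set" where
  "cline x \<equiv> complex_vector.span {x}"

lemma scaleC_in_cline [simp]: "c *\<^sub>C x \<in> cline x"
  by (intro complex_vector.span_scale complex_vector.span_base) simp

lemma clineE:
  assumes "x \<in> cline y"
  obtains c where "x = c *\<^sub>C y"
  using assms by (auto simp: complex_vector.span_singleton)

lemma cline_sym:
  assumes "x \<in> cline y" "x \<noteq> 0"
  shows "y \<in> cline x"
proof -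
  obtain c where c: "x = c *\<^sub>C y" using assms(1) by (rule clineE)
  then have "c \<noteq> 0" using assms(2) by auto
  then have "y = inverse c *\<^sub>C x" by (simp add: c scaleC_scaleC scaleC_one)
  then show ?thesis by (metis scaleC_in_cline)
qed

lemma dyad_of_cline:
  assumes "x \<in> cline y"
  shows "\<exists>r\<ge>0. dyad x = r *\<^sub>R dyad y"
proof -
  obtain c where "x = c *\<^sub>C y" using assms by (rule clineE)
  then show ?thesis by (intro exI[of _ "(cmod c)\<^sup>2"]) (simp add: dyad_scaleC)
qed

text \<open>Such vectors \<open>w\<close> take the place of coordinates: evaluating the quadratic forms of an operator
inequality at \<open>w\<close> removes the term with \<open>dyad y\<close> and keeps the one with \<open>dyad x\<close>.\<close>

lemma orthogonal_test_vector:
  assumes "x \<notin> cline y"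
  shows "\<exists>w. cinner w y = 0 \<and> cinner w x \<noteq> 0"
proof (cases "y = 0")
  case True
  then have "x \<noteq> 0" using assms complex_vector.span_zero by metis
  then show ?thesis using True by (intro exI[of _ x]) simp
next
  case False
  define w where "w = x - (cinner x y / cinner y y) *\<^sub>C y"
  have wy: "cinner w y = 0" using False by (simp add: w_def cinner_simps)
  have "w \<noteq> 0"
  proof
    assume "w = 0"
    then have "x = (cinner x y / cinner y y) *\<^sub>C y" by (simp add: w_def)
    then show False using assms by (metis scaleC_in_cline)
  qed
  moreover have "cinner w w = cinner w x"
    by (simp add: w_def cinner_diff_right cinner_scaleC_right wy[unfolded w_def])
  ultimately show ?thesis using wy by (intro exI[of _ w]) (metis cinner_self_eq_0)
qed

lemma dyad_le_imp_cline:
  assumes "dyad x \<preceq> r *\<^sub>R dyad y"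
  shows "x \<in> cline y"
proof (rule ccontr)
  assume "x \<notin> cline y"
  then obtain w where "cinner w y = 0" "cinner w x \<noteq> 0" using orthogonal_test_vector by blast
  moreover have "(cmod (cinner w x))\<^sup>2 \<le> r * (cmod (cinner w y))\<^sup>2"
    using assms by (simp add: qle_def dyad_form blinfun.bilinear_simps)
  ultimately show False by simp
qed

lemma dyad_eq_iff: "dyad x = dyad y \<longleftrightarrow> (\<exists>c. cmod c = 1 \<and> x = c *\<^sub>C y)"
proof
  assume eq: "dyad x = dyad y"
  show "\<exists>c. cmod c = 1 \<and> x = c *\<^sub>C y"
  proof (cases "y = 0")
    case True
    then show ?thesis using eq by (intro exI[of _ 1]) (simp add: scaleC_one)
  next
    case False
    obtain c where c: "x = c *\<^sub>C y" using dyad_le_imp_cline[of x 1 y] eq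
      by (auto elim: clineE)
    have "((cmod c)\<^sup>2 - 1) *\<^sub>R dyad y = 0" using eq by (simp add: c dyad_scaleC algebra_simps)
    then have "(cmod c)\<^sup>2 = 1" using False by simp
    then have "cmod c = 1" using power2_eq_iff_nonneg[of "cmod c" 1] by simp
    then show ?thesis using c by blast
  qed
next
  assume "\<exists>c. cmod c = 1 \<and> x = c *\<^sub>C y"
  then show "dyad x = dyad y" by (auto simp: dyad_scaleC)
qed

lemma scaleR_dyad_le_iff:
  assumes "x \<noteq> 0"
  shows "s *\<^sub>R dyad x \<preceq> t *\<^sub>R dyad x \<longleftrightarrow> s \<le> t"
proof
  assume "s *\<^sub>R dyad x \<preceq> t *\<^sub>R dyad x"
  then have "s * (cmod (cinner x x))\<^sup>2 \<le> t * (cmod (cinner x x))\<^sup>2"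
    unfolding qle_def by (metis dyad_form blinfun.scaleR_left inner_scaleR_left)
  moreover have "(cmod (cinner x x))\<^sup>2 > 0" using assms by simp
  ultimately show "s \<le> t" by (simp add: mult_le_cancel_right)
next
  assume "s \<le> t"
  then show "s *\<^sub>R dyad x \<preceq> t *\<^sub>R dyad x"
    by (simp add: qle_def dyad_form blinfun.bilinear_simps mult_right_mono)
qed

lemma dyad_parallelogram: "dyad (x + y) + dyad (x - y) = 2 *\<^sub>R dyad x + 2 *\<^sub>R dyad y"
  by (rule blinfun_eqI)
    (simp add: dyad_apply blinfun.bilinear_simps cinner_simps algebra_simps scaleR_2
      complex_vector.scale_left_diff_distrib complex_vector.scale_right_diff_distrib
      scaleC_add_right scaleC_add_left)

text \<open>This is the Cauchy--Schwarz inequality \<open>\<bar>\<langle>u, M y\<rangle>\<bar>\<^sup>2 \<le> \<langle>M u, u\<rangle> * \<langle>M y, y\<rangle>\<close>. It provides an operator of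
rank one below \<open>M\<close> in the direction of any nonzero vector of the range, and without any use of
square roots of operators.\<close>

lemma dyad_image_le:
  assumes M: "M \<in> hermitian" "0 \<preceq> M" and pos: "inner (M y) y > 0"
  shows "dyad (of_real (1 / sqrt (inner (M y) y)) *\<^sub>C M y) \<preceq> M"
proof -
  have "dyad (of_real (1 / sqrt (inner (M y) y)) *\<^sub>C M y) = (1 / inner (M y) y) *\<^sub>R dyad (M y)"
    using pos by (simp add: dyad_scaleC norm_divide power_divide)
  moreover have "(cmod (cinner u (M y)))\<^sup>2 \<le> inner (M u) u * inner (M y) y" for u
    using positive_cauchy_schwarz[OF M, of u y] M(1) by (simp add: hermitian_cinner)
  ultimately show ?thesis
    using pos by (simp add: qle_def blinfun.bilinear_simps dyad_form field_simps)
qed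

text \<open>The operator of rank one from the preceding inequality has the same quadratic form as \<open>A\<close> at
the point \<open>y\<close>. Hence a positive operator is determined by the operators of rank one below it,
which reduces the study of an order automorphism to its action on these.\<close>

lemma positive_le_if_dyads_le:
  assumes A: "A \<in> hermitian" "0 \<preceq> A" and B: "0 \<preceq> B"
    and dyads: "\<And>z. dyad z \<preceq> A \<Longrightarrow> dyad z \<preceq> B"
  shows "A \<preceq> B"
  unfolding qle_def
proof
  fix y
  show "inner (A y) y \<le> inner (B y) y"
  proof (cases "inner (A y) y = 0")
    case True
    then show ?thesis using B by (simp add: qle_def)
  next
    case False
    then have pos: "inner (A y) y > 0" using A(2) by (simp add: qle_def less_le)
    let ?z = "complex_of_real (1 / sqrt (inner (A y) y)) *\<^sub>C A y"
    have "cinner (A y) y = of_real (inner (A y) y)"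
      using hermitian_cinner[OF A(1), of y y] cinner_commute[of "A y" y]
      by (simp add: inner_eq_Re_cinner complex_eq_iff)
    then have "cmod (cinner y (A y)) = inner (A y) y"
      using pos by (simp add: cmod_cinner_commute[of y])
    then have "inner (dyad ?z y) y = inner (A y) y"
      using pos by (simp add: dyad_scaleC norm_divide power_divide blinfun.bilinear_simps dyad_form
          power2_eq_square)
    moreover have "dyad ?z \<preceq> B" by (intro dyads dyad_image_le A pos)
    ultimately show ?thesis unfolding qle_def by metis
  qed
qed

text \<open>Subtracting from \<open>u\<close> its component along \<open>x\<close> shows that \<open>M u\<close> depends on \<open>\<langle>u, x\<rangle>\<close> only, and by
symmetry \<open>\<langle>M u, v\<rangle>\<close> depends on \<open>v\<close> through \<open>\<langle>v, x\<rangle>\<close> only.\<close>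

lemma multiple_of_dyad:
  assumes M: "M \<in> hermitian" "0 \<preceq> M" and "x \<noteq> 0"
    and kill: "\<And>u. cinner u x = 0 \<Longrightarrow> M u = 0"
  shows "\<exists>s\<ge>0. M = s *\<^sub>R dyad x"
proof -
  define c where "c = cinner x x"
  have c: "c \<noteq> 0" using \<open>x \<noteq> 0\<close> by (simp add: c_def)
  have val: "M u = (cinner u x / c) *\<^sub>C M x" for u
  proof -
    have "M (u - (cinner u x / c) *\<^sub>C x) = 0"
      using c by (intro kill) (simp add: cinner_simps c_def)
    then show ?thesis using M(1) by (simp add: blinfun.diff_right hermitian_scaleC)
  qed
  define n where "n = (norm x)\<^sup>2"
  have n: "c = of_real n" "n \<noteq> 0" using \<open>x \<noteq> 0\<close> by (simp_all add: c_def n_def cinner_self)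
  define s where "s = inner (M x) x / n / n"
  have Mx: "cinner (M x) x = of_real (inner (M x) x)"
    using hermitian_cinner[OF M(1), of x x] cinner_commute[of "M x" x]
    by (simp add: inner_eq_Re_cinner complex_eq_iff)
  have "M = s *\<^sub>R dyad x"
  proof (intro blinfun_eqI cinner_eqI)
    fix u v
    have "cinner (M u) v = (cinner u x / c) * cinner x (M v)"
      by (subst val) (simp add: cinner_scaleC_left hermitian_cinner[OF M(1)])
    also have "cinner x (M v) = cnj (cinner v x / c) * cinner x (M x)"
      by (subst val) (simp add: cinner_scaleC_right)
    also have "cinner x (M x) = of_real (inner (M x) x)"
      using Mx hermitian_cinner[OF M(1), of x x] by simp
    finally show "cinner (M u) v = cinner ((s *\<^sub>R dyad x) u) v"
      using n by (simp add: s_def blinfun.bilinear_simps dyad_apply cinner_simps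
          cinner_commute[of x v] field_simps)
  qed
  moreover have "s \<ge> 0" using M(2) by (simp add: s_def qle_def)
  ultimately show ?thesis by blast
qed

lemma below_dyad:
  assumes M: "M \<in> hermitian" "0 \<preceq> M" "M \<preceq> dyad x"
  shows "\<exists>s\<ge>0. M = s *\<^sub>R dyad x"
proof (cases "x = 0")
  case True
  then show ?thesis using M qle_antisym[of M 0] by (intro exI[of _ 0]) auto
next
  case False
  have "M u = 0" if "cinner u x = 0" for u
    using M that by (intro positive_form_eq_0)
      (auto simp: qle_def dyad_form intro!: antisym dest: spec[of _ u])
  then show ?thesis using multiple_of_dyad[OF M(1,2) False] by blast
qed

text \<open>The description of rank one in terms of the order alone. If two vectors in the range of \<open>M\<close> are
linearly independent, then the two operators of rank one below \<open>M\<close> in their directions are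
incomparable; so if the interval from \<open>0\<close> to \<open>M\<close> is a chain, the range of \<open>M\<close> is a line.\<close>

lemma dyad_interval_chain_iff:
  assumes M: "M \<in> hermitian" "0 \<preceq> M"
  shows "(\<exists>x. M = dyad x) \<longleftrightarrow>
    (\<forall>C\<in>hermitian. \<forall>D\<in>hermitian. 0 \<preceq> C \<and> C \<preceq> M \<and> 0 \<preceq> D \<and> D \<preceq> M \<longrightarrow> C \<preceq> D \<or> D \<preceq> C)"
    (is "_ \<longleftrightarrow> ?chain")
proof
  assume "\<exists>x. M = dyad x"
  then obtain x where x: "M = dyad x" by blast
  show ?chain
  proof (intro ballI impI)
    fix C D assume "C \<in> hermitian" "D \<in> hermitian" "0 \<preceq> C \<and> C \<preceq> M \<and> 0 \<preceq> D \<and> D \<preceq> M"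
    then obtain s t where "C = s *\<^sub>R dyad x" "D = t *\<^sub>R dyad x" using below_dyad x by metis
    then show "C \<preceq> D \<or> D \<preceq> C"
      by (cases "x = 0") (auto simp: scaleR_dyad_le_iff)
  qed
next
  assume chain: ?chain
  show "\<exists>x. M = dyad x"
  proof (cases "\<exists>y. M y \<noteq> 0")
    case False
    then have "M = 0" by (intro blinfun_eqI) simp
    then show ?thesis by (intro exI[of _ 0]) simp
  next
    case True
    then obtain y where y: "M y \<noteq> 0" by blast
    have pos: "inner (M z) z > 0" if "M z \<noteq> 0" for z
      using positive_form_eq_0[OF M, of z] M(2) that by (auto simp: qle_def less_le)
    define v where "v z = complex_of_real (1 / sqrt (inner (M z) z)) *\<^sub>C M z" for z
    have line: "M z \<in> cline (M y)" if z: "M z \<noteq> 0" for z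
    proof -
      have ky: "1 / sqrt (inner (M y) y) \<noteq> 0" and kz: "1 / sqrt (inner (M z) z) \<noteq> 0"
        using pos y z by force+
      have "dyad (v z) \<preceq> dyad (v y) \<or> dyad (v y) \<preceq> dyad (v z)"
        using chain dyad_image_le[OF M pos[OF y]] dyad_image_le[OF M pos[OF z]]
        by (simp add: v_def)
      then have "v z \<in> cline (v y) \<or> v y \<in> cline (v z)"
        using dyad_le_imp_cline[of _ 1] by (metis scaleR_one)
      moreover have "v y \<noteq> 0" using y ky by (simp add: v_def complex_vector.scale_eq_0_iff)
      ultimately obtain d where d: "v z = d *\<^sub>C v y" by (metis clineE cline_sym)
      have "M z = inverse (of_real (1 / sqrt (inner (M z) z))) *\<^sub>C v z"
        unfolding v_def scaleC_scaleC using kz by (simp add: scaleC_one)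
      also have "\<dots> \<in> cline (M y)" unfolding d unfolding v_def scaleC_scaleC
        by (rule scaleC_in_cline)
      finally show ?thesis .
    qed
    have "M u = 0" if u: "cinner u (M y) = 0" for u
    proof (rule cinner_eqI)
      fix z
      have "cinner u (M z) = 0"
        using u line[of z] by (cases "M z = 0") (auto simp: cinner_scaleC_right elim!: clineE)
      then show "cinner (M u) z = cinner 0 z" using M(1) by (simp add: hermitian_cinner)
    qed
    then show ?thesis using multiple_of_dyad[OF M y] by (metis dyad_sqrt)
  qed
qed

section \<open>Order automorphisms and lines of rank one\<close>

locale order_automorphism =
  fixes \<phi> :: "('a :: complex_inner \<Rightarrow>\<^sub>L 'a) \<Rightarrow> ('a \<Rightarrow>\<^sub>L 'a)"
  assumes bij: "bij_betw \<phi> hermitian hermitian"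
    and le_iff: "A \<in> hermitian \<Longrightarrow> B \<in> hermitian \<Longrightarrow> \<phi> A \<preceq> \<phi> B \<longleftrightarrow> A \<preceq> B"
begin

lemma closed [simp]: "A \<in> hermitian \<Longrightarrow> \<phi> A \<in> hermitian"
  using bij by (auto simp: bij_betw_def)

lemma eq_iff: "A \<in> hermitian \<Longrightarrow> B \<in> hermitian \<Longrightarrow> \<phi> A = \<phi> B \<longleftrightarrow> A = B"
  using bij by (auto simp: bij_betw_def inj_on_def)

lemma onto:
  assumes "B \<in> hermitian"
  obtains A where "A \<in> hermitian" "\<phi> A = B"
  using bij_betw_imp_surj_on[OF bij] assms by (metis imageE)

lemma inverse: "order_automorphism (inv_into hermitian \<phi>)"
proof
  show bij': "bij_betw (inv_into hermitian \<phi>) hermitian hermitian"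
    using bij by (rule bij_betw_inv_into)
  fix A B :: "'a \<Rightarrow>\<^sub>L 'a" assume AB: "A \<in> hermitian" "B \<in> hermitian"
  have "inv_into hermitian \<phi> C \<in> hermitian" "\<phi> (inv_into hermitian \<phi> C) = C"
    if "C \<in> hermitian" for C
    using that bij bij' by (auto simp: bij_betw_inv_into_right bij_betw_def)
  then show "inv_into hermitian \<phi> A \<preceq> inv_into hermitian \<phi> B \<longleftrightarrow> A \<preceq> B"
    using AB le_iff by metis
qed

lemma translate:
  assumes A: "A \<in> hermitian"
  shows "order_automorphism (\<lambda>B. \<phi> (A + B) - \<phi> A)"
proof
  have t: "bij_betw ((+) C) hermitian hermitian" if "C \<in> hermitian" for C :: "'a \<Rightarrow>\<^sub>L 'a"
    using that hermitian_diff[of _ C]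
    by (intro bij_betwI[where g = "\<lambda>B. B - C"]) (auto simp: hermitian_add)
  have "- \<phi> A \<in> hermitian" using hermitian_diff[of 0 "\<phi> A"] A by simp
  then have "bij_betw ((+) (- \<phi> A) \<circ> (\<phi> \<circ> (+) A)) hermitian hermitian"
    using t bij A by (blast intro: bij_betw_trans)
  then show "bij_betw (\<lambda>B. \<phi> (A + B) - \<phi> A) hermitian hermitian" by (simp add: o_def)
  fix B C :: "'a \<Rightarrow>\<^sub>L 'a" assume "B \<in> hermitian" "C \<in> hermitian"
  then have "\<phi> (A + B) \<preceq> \<phi> (A + C) \<longleftrightarrow> B \<preceq> C" using A by (simp add: le_iff hermitian_add)
  then show "\<phi> (A + B) - \<phi> A \<preceq> \<phi> (A + C) - \<phi> A \<longleftrightarrow> B \<preceq> C" by simp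
qed

text \<open>Having a difference of rank one is expressed by the order alone, hence it is preserved.\<close>

lemma dyad_step:
  assumes A: "A \<in> hermitian"
  shows "\<exists>y. \<phi> (A + dyad x) = \<phi> A + dyad y"
proof -
  let ?M = "\<phi> (A + dyad x) - \<phi> A"
  have Ax: "A + dyad x \<in> hermitian" using A by auto
  have M: "?M \<in> hermitian" "0 \<preceq> ?M" using A Ax by (auto simp: qle_diff_iff le_iff)
  have pull: "\<exists>C'\<in>hermitian. \<phi> (A + C') = \<phi> A + C \<and> 0 \<preceq> C' \<and> C' \<preceq> dyad x"
    if C: "C \<in> hermitian" "0 \<preceq> C" "C \<preceq> ?M" for C
  proof -
    obtain D where D: "D \<in> hermitian" "\<phi> D = \<phi> A + C"
      using onto[of "\<phi> A + C"] A C(1) by auto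
    have "\<phi> A \<preceq> \<phi> D" "\<phi> D \<preceq> \<phi> (A + dyad x)"
      using C(2,3) qle_add_left_iff[of "\<phi> A" C ?M] D by simp_all
    then have "A \<preceq> D" "D \<preceq> A + dyad x" using A D Ax le_iff[of A D] le_iff[of D "A + dyad x"] by blast+
    then have "0 \<preceq> D - A" "D - A \<preceq> dyad x"
      by (simp_all add: qle_diff_iff qle_diff_le_iff)
    then show ?thesis using A D by (intro bexI[of _ "D - A"]) auto
  qed
  have "\<exists>y. ?M = dyad y"
    unfolding dyad_interval_chain_iff[OF M]
  proof (intro ballI impI)
    fix C D assume "C \<in> hermitian" "D \<in> hermitian" "0 \<preceq> C \<and> C \<preceq> ?M \<and> 0 \<preceq> D \<and> D \<preceq> ?M"
    then obtain C' D' where C': "C' \<in> hermitian" "\<phi> (A + C') = \<phi> A + C" "0 \<preceq> C'" "C' \<preceq> dyad x"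
      and D': "D' \<in> hermitian" "\<phi> (A + D') = \<phi> A + D" "0 \<preceq> D'" "D' \<preceq> dyad x"
      using pull by metis
    have "C' \<preceq> D' \<or> D' \<preceq> C'"
      using dyad_interval_chain_iff[of "dyad x"] C' D' by fastforce
    then have "\<phi> (A + C') \<preceq> \<phi> (A + D') \<or> \<phi> (A + D') \<preceq> \<phi> (A + C')"
      using C'(1) D'(1) A by (simp add: le_iff hermitian_add)
    then show "C \<preceq> D \<or> D \<preceq> C" by (simp add: C' D')
  qed
  then show ?thesis by (metis add_diff_cancel_left' diff_add_cancel add.commute)
qed

text \<open>Two points of the line \<open>A + t *\<^sub>R dyad x\<close> differ by an operator of rank one, and so do their images.
The images of the points \<open>0 \<le> t\<close> lie above \<open>\<phi> A\<close>, so that comparing the increments with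
\<open>dyad a\<close> shows them to be parallel; for \<open>t < 0\<close> the increment is measured up to the point \<open>t = 1\<close>,
because only increments of an increasing pair are known to be of the form \<open>dyad y\<close>.\<close>

lemma line_into_line:
  assumes A: "A \<in> hermitian" and x: "x \<noteq> 0" and a: "\<phi> (A + dyad x) = \<phi> A + dyad a"
  shows "\<exists>r. \<phi> (A + t *\<^sub>R dyad x) = \<phi> A + r *\<^sub>R dyad a"
proof -
  have "\<phi> (A + dyad x) \<noteq> \<phi> A" using A x by (subst eq_iff) auto
  then have a0: "a \<noteq> 0" using a by auto
  define L where "L t = \<phi> (A + t *\<^sub>R dyad x)" for t
  have L01: "L 0 = \<phi> A" "L 1 = \<phi> A + dyad a" by (simp_all add: L_def a)
  have step: "\<exists>y. L t = L s + dyad y" if "s \<le> t" for s t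
    using dyad_step[of "A + s *\<^sub>R dyad x" "of_real (sqrt (t - s)) *\<^sub>C x"] A that
    by (auto simp: L_def dyad_sqrt hermitian_add hermitian_scaleR add.assoc
        simp flip: scaleR_add_left)
  have mono: "L s \<preceq> L t" if "s \<le> t" for s t
    using A that x by (simp add: L_def le_iff scaleR_dyad_le_iff)
  have below: "\<exists>r. dyad y = r *\<^sub>R dyad a" if "dyad y \<preceq> dyad a" for y
    by (metis that dyad_le_imp_cline dyad_of_cline scaleR_one)
  have above: "\<exists>r. dyad y = r *\<^sub>R dyad a" if "dyad a \<preceq> dyad y" for y
    by (metis that a0 cline_sym dyad_le_imp_cline dyad_of_cline scaleR_one)
  consider "t \<ge> 1" | "0 \<le> t" "t \<le> 1" | "t \<le> 0" by linarith
  then have "\<exists>r. L t = \<phi> A + r *\<^sub>R dyad a"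
  proof cases
    case 1
    obtain y where y: "L t = L 0 + dyad y" using step[of 0 t] 1 by auto
    have "dyad a \<preceq> dyad y" using mono[of 1 t] 1 by (simp add: y L01)
    then obtain r where "dyad y = r *\<^sub>R dyad a" using above by blast
    then have "L t = \<phi> A + r *\<^sub>R dyad a" by (simp add: y L01)
    then show ?thesis by blast
  next
    case 2
    obtain y where y: "L t = L 0 + dyad y" using step[of 0 t] 2 by auto
    have "dyad y \<preceq> dyad a" using mono[of t 1] 2 y L01 by (metis qle_add_left_iff)
    then obtain r where "dyad y = r *\<^sub>R dyad a" using below by blast
    then have "L t = \<phi> A + r *\<^sub>R dyad a" by (simp add: y L01)
    then show ?thesis by blast
  next
    case 3
    obtain y where y: "L 1 = L t + dyad y" using step[of t 1] 3 by auto
    then have Lt: "L t = \<phi> A + (dyad a - dyad y)" by (simp add: L01 algebra_simps)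
    have "L t \<preceq> L 0" using mono 3 by blast
    then have "dyad a \<preceq> dyad y" unfolding Lt L01 by (simp add: qle_diff_le_iff)
    then obtain r where "dyad y = r *\<^sub>R dyad a" using above by blast
    then have "L t = \<phi> A + (1 - r) *\<^sub>R dyad a" by (simp add: Lt scaleR_left_diff_distrib)
    then show ?thesis by blast
  qed
  then show ?thesis by (simp add: L_def)
qed

text \<open>The inverse of \<open>\<phi>\<close> is an order automorphism as well and maps the image line back to the given one;
hence the parameter change \<open>f\<close> is onto.\<close>

lemma line_onto_line:
  assumes A: "A \<in> hermitian" and x: "x \<noteq> 0"
  obtains a f where "a \<noteq> 0" "strict_mono f" "surj f" "f 0 = 0" "f 1 = (1 :: real)"
    "\<And>t. \<phi> (A + t *\<^sub>R dyad x) = \<phi> A + f t *\<^sub>R dyad a"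
proof -
  obtain a where a: "\<phi> (A + dyad x) = \<phi> A + dyad a" using dyad_step A by blast
  have "\<phi> (A + dyad x) \<noteq> \<phi> A" using A x by (subst eq_iff) auto
  then have a0: "a \<noteq> 0" using a by auto
  obtain f where f: "\<And>t. \<phi> (A + t *\<^sub>R dyad x) = \<phi> A + f t *\<^sub>R dyad a"
    using line_into_line[OF A x a] by metis
  have le: "f s \<le> f t \<longleftrightarrow> s \<le> t" for s t
  proof -
    have "f s \<le> f t \<longleftrightarrow> \<phi> (A + s *\<^sub>R dyad x) \<preceq> \<phi> (A + t *\<^sub>R dyad x)"
      by (simp add: f scaleR_dyad_le_iff a0)
    also have "\<dots> \<longleftrightarrow> s \<le> t" using A x by (subst le_iff) (auto simp: scaleR_dyad_le_iff)
    finally show ?thesis .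
  qed
  have mono: "strict_mono f" by (intro strict_monoI) (meson le not_le)
  interpret inv: order_automorphism "inv_into hermitian \<phi>" by (rule inverse)
  have inv: "inv_into hermitian \<phi> (\<phi> B) = B" if "B \<in> hermitian" for B
    using bij that by (simp add: bij_betw_inv_into_left)
  have "\<exists>t. f t = r" for r
  proof -
    have "inv_into hermitian \<phi> (\<phi> A + dyad a) = A + dyad x"
      using inv[OF hermitian_add[OF A hermitian_dyad[of x]]] by (simp only: a)
    then obtain t where t: "inv_into hermitian \<phi> (\<phi> A + r *\<^sub>R dyad a) = A + t *\<^sub>R dyad x"
      using inv.line_into_line[of "\<phi> A" a x r] A a0 inv[of A] by auto
    have "\<phi> A + r *\<^sub>R dyad a \<in> \<phi> ` hermitian"
      by (simp add: bij_betw_imp_surj_on[OF bij] A hermitian_add hermitian_scaleR)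
    then have "\<phi> A + r *\<^sub>R dyad a = \<phi> (A + t *\<^sub>R dyad x)" by (metis t f_inv_into_f)
    then have "r *\<^sub>R dyad a = f t *\<^sub>R dyad a" by (simp add: f)
    then show ?thesis using a0 by auto
  qed
  then have "surj f" by (metis surjI)
  moreover have "f 0 = 0" using f[of 0] a0 by simp
  moreover have "f 1 *\<^sub>R dyad a = 1 *\<^sub>R dyad a" using f[of 1] a by simp
  then have "f 1 = 1" by (metis a0 dyad_eq_0 scaleR_cancel_right)
  ultimately show ?thesis using that a0 mono f by blast
qed

text \<open>The increment of \<open>\<phi>\<close> along a line of direction \<open>dyad x\<close> does not change when the line is moved by
\<open>dyad z\<close>, where \<open>z\<close> and \<open>x\<close> are not parallel. Let \<open>f\<close>, \<open>g\<close> be the parameter changes and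
\<open>dyad a\<close>, \<open>dyad b\<close> the directions of the two image lines. The point \<open>t\<close> of the first line lies
below the point \<open>s\<close> of the second one precisely if \<open>t \<le> s\<close>, and therefore
\<open>f t *\<^sub>R dyad a \<preceq> dyad c + g s *\<^sub>R dyad b \<longleftrightarrow> t \<le> s\<close>.
If \<open>a\<close> and \<open>b\<close> were not parallel, this would fail for \<open>s = t\<close> close to minus infinity; if they are
parallel, it forces \<open>f = g\<close> up to the normalisation of \<open>b\<close>.\<close>

lemma dyad_increment_off_line:
  assumes A: "A \<in> hermitian" and z: "z \<notin> cline x"
  shows "\<phi> (A + dyad z + t *\<^sub>R dyad x) - \<phi> (A + dyad z) = \<phi> (A + t *\<^sub>R dyad x) - \<phi> A"
proof (cases "x = 0")
  case False
  let ?B = "A + dyad z"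
  have B: "?B \<in> hermitian" using A by auto
  obtain a f where a: "a \<noteq> 0" and f: "strict_mono f" "surj f"
    "\<And>t. \<phi> (A + t *\<^sub>R dyad x) = \<phi> A + f t *\<^sub>R dyad a"
    using line_onto_line[OF A False] by metis
  obtain b g where b: "b \<noteq> 0" and g: "strict_mono g" "surj g"
    "\<And>t. \<phi> (?B + t *\<^sub>R dyad x) = \<phi> ?B + g t *\<^sub>R dyad b"
    using line_onto_line[OF B False] by metis
  obtain c where c: "\<phi> ?B = \<phi> A + dyad c" using dyad_step A by blast
  have order: "f t *\<^sub>R dyad a \<preceq> dyad c + g s *\<^sub>R dyad b \<longleftrightarrow> t \<le> s" for t s
  proof -
    have "f t *\<^sub>R dyad a \<preceq> dyad c + g s *\<^sub>R dyad b \<longleftrightarrow> \<phi> (A + t *\<^sub>R dyad x) \<preceq> \<phi> (?B + s *\<^sub>R dyad x)"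
      by (simp only: f g c) (simp add: add.assoc)
    also have "\<dots> \<longleftrightarrow> A + t *\<^sub>R dyad x \<preceq> ?B + s *\<^sub>R dyad x"
      by (intro le_iff hermitian_add hermitian_scaleR A B hermitian_dyad)
    also have "\<dots> \<longleftrightarrow> t *\<^sub>R dyad x \<preceq> dyad z + s *\<^sub>R dyad x" by (simp add: add.assoc)
    also have "\<dots> \<longleftrightarrow> t \<le> s"
    proof
      assume le: "t *\<^sub>R dyad x \<preceq> dyad z + s *\<^sub>R dyad x"
      have "x \<notin> cline z" using z cline_sym False by blast
      then obtain w where w: "cinner w z = 0" "cinner w x \<noteq> 0" using orthogonal_test_vector by blast
      have "t * (cmod (cinner w x))\<^sup>2 \<le> s * (cmod (cinner w x))\<^sup>2"
        using le[unfolded qle_def, rule_format, of w] w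
        by (simp add: blinfun.bilinear_simps inner_simps dyad_form)
      then show "t \<le> s" using w(2) by simp
    next
      assume "t \<le> s"
      then have "t *\<^sub>R dyad x \<preceq> s *\<^sub>R dyad x" using False by (simp add: scaleR_dyad_le_iff)
      moreover have "s *\<^sub>R dyad x \<preceq> dyad z + s *\<^sub>R dyad x" by simp
      ultimately show "t *\<^sub>R dyad x \<preceq> dyad z + s *\<^sub>R dyad x" by (rule qle_trans)
    qed
    finally show ?thesis .
  qed
  have "b \<in> cline a"
  proof (rule ccontr)
    assume "b \<notin> cline a"
    then obtain w where w: "cinner w a = 0" "cinner w b \<noteq> 0" using orthogonal_test_vector by blast
    let ?k = "(cmod (cinner w b))\<^sup>2"
    (* a parameter so small that the contribution of dyad c no longer compensates it *)
    obtain t where t: "g t = - ((cmod (cinner w c))\<^sup>2 + 1) / ?k" using g(2) by (metis surj_def)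
    have "f t *\<^sub>R dyad a \<preceq> dyad c + g t *\<^sub>R dyad b" using order by simp
    then have "0 \<le> (cmod (cinner w c))\<^sup>2 + g t * ?k"
      using w(1) unfolding qle_def
      by (auto simp: blinfun.bilinear_simps inner_simps dyad_form dest: spec[of _ w])
    then show False using w(2) by (simp add: t)
  qed
  then obtain k where k: "k \<ge> 0" "dyad b = k *\<^sub>R dyad a" using dyad_of_cline by blast
  then have "k \<noteq> 0" using b by auto
  then have "k > 0" using k by simp
  (* with h in place of g, both image lines are parametrised by the same direction dyad a *)
  define h where "h t = g t * k" for t
  have h: "strict_mono h" "surj h"
    "\<And>t. \<phi> (?B + t *\<^sub>R dyad x) = \<phi> ?B + h t *\<^sub>R dyad a"
  proof -
    show "strict_mono h" using g(1) \<open>k > 0\<close> by (simp add: h_def strict_mono_def)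
    show "surj h"
    proof (rule surjI[of _ "\<lambda>r. inv g (r / k)"])
      show "h (inv g (r / k)) = r" for r
        using g(2) \<open>k > 0\<close> by (simp add: h_def surj_f_inv_f)
    qed
  qed (simp add: g(3) h_def k)
  (* otherwise the image of B would lie on the image of the first line *)
  have "a \<notin> cline c"
  proof
    assume ac: "a \<in> cline c"
    then have "c \<in> cline a" using a by (metis cline_sym)
    then obtain r where r: "dyad c = r *\<^sub>R dyad a" using dyad_of_cline by blast
    obtain t where "f t = r" using f(2) by (metis surj_def)
    then have "\<phi> ?B = \<phi> (A + t *\<^sub>R dyad x)" by (simp add: c f r)
    then have "?B = A + t *\<^sub>R dyad x" using A B
      by (subst (asm) eq_iff) (auto simp: hermitian_add hermitian_scaleR)
    then have "dyad z \<preceq> t *\<^sub>R dyad x" by simp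
    then show False using dyad_le_imp_cline[of z t x] z by simp
  qed
  then obtain w where w: "cinner w c = 0" "cinner w a \<noteq> 0" using orthogonal_test_vector by blast
  have fh: "f t \<le> h s \<longleftrightarrow> t \<le> s" for t s
  proof
    assume "t \<le> s"
    then have "f t *\<^sub>R dyad a \<preceq> dyad c + h s *\<^sub>R dyad a" using order[of t s] by (simp add: h_def k)
    then have "f t * (cmod (cinner w a))\<^sup>2 \<le> h s * (cmod (cinner w a))\<^sup>2"
      using w(1) unfolding qle_def
      by (auto simp: blinfun.bilinear_simps inner_simps dyad_form dest: spec[of _ w])
    then show "f t \<le> h s" using w(2) by simp
  next
    assume "f t \<le> h s"
    then have "f t *\<^sub>R dyad a \<preceq> h s *\<^sub>R dyad a" using a by (simp add: scaleR_dyad_le_iff)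
    also have "h s *\<^sub>R dyad a \<preceq> dyad c + h s *\<^sub>R dyad a" by simp
    finally (qle_trans) have "f t *\<^sub>R dyad a \<preceq> dyad c + g s *\<^sub>R dyad b" by (simp add: h_def k)
    then show "t \<le> s" using order by blast
  qed
  have "f t = h t"
  proof -
    obtain s where s: "h s = f t" using h(2) by (metis surj_def)
    then have "t \<le> s" using fh[of t s] by simp
    moreover have "s \<le> t"
      using fh[of t t] s h(1) by (metis order_refl strict_mono_less_eq)
    ultimately show ?thesis using s by simp
  qed
  then show ?thesis by (simp add: f(3) h(3))
qed simp

end

section \<open>Linearity on operators of finite rank\<close>

text \<open>An additive function is linear on the rational numbers, and monotonicity squeezes its other
values between rational ones.\<close>

lemma additive_mono_imp_linear:
  fixes f :: "real \<Rightarrow> real"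
  assumes add: "\<And>s t. f (s + t) = f s + f t" and mono: "mono f"
  shows "f t = t * f 1"
proof -
  have f0: "f 0 = 0" using add[of 0 0] by simp
  have neg: "f (- t) = - f t" for t using add[of t "- t"] f0 by simp
  have nat: "f (of_nat n * t) = of_nat n * f t" for n t
    by (induction n) (simp_all add: f0 add algebra_simps)
  have int: "f (of_int k * t) = of_int k * f t" for k t
    by (cases k rule: int_cases2) (simp_all add: nat neg)
  have rat: "f t = t * f 1" if q: "t \<in> \<rat>" for t
  proof -
    obtain k n :: int where n: "n > 0" and t: "t = of_int k / of_int n"
      using Rats_cases'[OF q] by blast
    have "of_int n * f t = f (of_int n * t)" by (simp only: int)
    also have "of_int n * t = of_int k * 1" using n by (simp add: t)
    also have "f \<dots> = of_int k * f 1" by (simp only: int)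
    finally show ?thesis using n by (simp add: t field_simps)
  qed
  have f1: "f 1 \<ge> 0" using monoD[OF mono, of 0 1] f0 by simp
  show ?thesis
  proof (rule antisym)
    show "f t \<le> t * f 1"
    proof (rule field_le_epsilon)
      fix e :: real assume "e > 0"
      then have "t < t + e / (f 1 + 1)" using f1 by simp
      then obtain q where q: "q \<in> \<rat>" "t < q" "q < t + e / (f 1 + 1)" using Rats_dense_in_real by blast
      have "f t \<le> q * f 1" using monoD[OF mono, of t q] q rat[of q] by simp
      also have "\<dots> \<le> (t + e / (f 1 + 1)) * f 1" using q f1 by (intro mult_right_mono) auto
      also have "\<dots> \<le> t * f 1 + e" using f1 \<open>e > 0\<close> by (simp add: field_simps)
      finally show "f t \<le> t * f 1 + e" .
    qed
    show "t * f 1 \<le> f t"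
    proof (rule field_le_epsilon)
      fix e :: real assume "e > 0"
      then have "t - e / (f 1 + 1) < t" using f1 by simp
      then obtain q where q: "q \<in> \<rat>" "t - e / (f 1 + 1) < q" "q < t" using Rats_dense_in_real by blast
      have "t * f 1 - e \<le> (t - e / (f 1 + 1)) * f 1" using f1 \<open>e > 0\<close> by (simp add: field_simps)
      also have "\<dots> \<le> q * f 1" using q f1 by (intro mult_right_mono) auto
      also have "\<dots> \<le> f t" using monoD[OF mono, of q t] q rat[of q] by simp
      finally show "t * f 1 \<le> f t + e" by simp
    qed
  qed
qed

text \<open>For \<open>w\<close> not on the line of \<open>x\<close>, neither are \<open>x + w\<close> and \<open>x - w\<close>. Thus the identity writes a
translation along the line of \<open>x\<close> as a combination of translations in other directions.\<close>

lemma dyad_add_rotated: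
  "dyad x + dyad w = dyad ((1 / sqrt 2) *\<^sub>R (x + w)) + dyad ((1 / sqrt 2) *\<^sub>R (x - w))"
proof -
  have "dyad ((1 / sqrt 2) *\<^sub>R y) = (1 / 2) *\<^sub>R dyad y" for y :: 'a
    unfolding scaleR_scaleC dyad_scaleC norm_of_real by (simp add: power_divide)
  from this[of "x + w"] this[of "x - w"]
  have "dyad ((1 / sqrt 2) *\<^sub>R (x + w)) + dyad ((1 / sqrt 2) *\<^sub>R (x - w))
      = (1 / 2) *\<^sub>R dyad (x + w) + (1 / 2) *\<^sub>R dyad (x - w)" by (simp only:)
  also have "\<dots> = (1 / 2) *\<^sub>R (dyad (x + w) + dyad (x - w))" by (rule scaleR_add_right[symmetric])
  also have "\<dots> = dyad x + dyad w" unfolding dyad_parallelogram by (simp add: scaleR_add_right)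
  finally show ?thesis ..
qed

definition finite_rank_hermitian :: "('a :: complex_inner \<Rightarrow>\<^sub>L 'a) set" where
  "finite_rank_hermitian = span (range dyad)"

lemma finite_rank_subset: "finite_rank_hermitian \<subseteq> hermitian"
  unfolding finite_rank_hermitian_def
  by (intro span_minimal subspace_hermitian) auto

lemma finite_rank_hermitianD [simp]: "A \<in> finite_rank_hermitian \<Longrightarrow> A \<in> hermitian"
  using finite_rank_subset by blast

lemma finite_rank_hermitian_closed [simp]:
  "dyad x \<in> finite_rank_hermitian" "0 \<in> finite_rank_hermitian"
  "A \<in> finite_rank_hermitian \<Longrightarrow> B \<in> finite_rank_hermitian \<Longrightarrow> A + B \<in> finite_rank_hermitian"
  "A \<in> finite_rank_hermitian \<Longrightarrow> B \<in> finite_rank_hermitian \<Longrightarrow> A - B \<in> finite_rank_hermitian"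
  "A \<in> finite_rank_hermitian \<Longrightarrow> r *\<^sub>R A \<in> finite_rank_hermitian"
  by (simp_all add: finite_rank_hermitian_def span_base span_zero span_add span_diff span_scale)

lemma finite_rank_induct [consumes 1, case_names zero add]:
  assumes "K \<in> finite_rank_hermitian" "P 0"
    "\<And>K r x. K \<in> finite_rank_hermitian \<Longrightarrow> P K \<Longrightarrow> P (K + r *\<^sub>R dyad x)"
  shows "P K"
proof -
  have "K \<in> finite_rank_hermitian \<and> P K"
    using assms(1) unfolding finite_rank_hermitian_def
  proof (induction rule: span_induct_alt)
    case base
    then show ?case using assms(2) by (simp add: span_zero)
  next
    case (step c D K)
    then obtain x where "D = dyad x" by blast
    then show ?case using step assms(3)[of K c x]
      by (simp add: finite_rank_hermitian_def add.commute span_add span_scale span_base)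
  qed
  then show ?thesis ..
qed

text \<open>The dimension enters only here. On a one-dimensional space the self-adjoint operators form the
real line, where every increasing bijection is an order automorphism.\<close>

locale order_automorphism_dim_ge_2 = order_automorphism \<phi>
  for \<phi> :: "('a :: complex_inner \<Rightarrow>\<^sub>L 'a) \<Rightarrow> ('a \<Rightarrow>\<^sub>L 'a)" +
  assumes not_line: "\<exists>w :: 'a. w \<notin> cline x"
begin

text \<open>The case of parallel \<open>z\<close> and \<open>x\<close> is reduced to the other one by a detour: first
\<open>dyad w\<close> is added, and then the sum \<open>dyad z + dyad w\<close> is replaced by two operators whose
directions are not parallel to \<open>x\<close>.\<close>

lemma dyad_increment_add_dyad:
  assumes A: "A \<in> hermitian"
  shows "\<phi> (A + dyad z + t *\<^sub>R dyad x) - \<phi> (A + dyad z) = \<phi> (A + t *\<^sub>R dyad x) - \<phi> A"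
proof (cases "z \<in> cline x \<and> z \<noteq> 0")
  case False
  then consider "z = 0" | "z \<notin> cline x" by blast
  then show ?thesis using dyad_increment_off_line[OF A] by cases auto
next
  case True
  define D where "D B = \<phi> (B + t *\<^sub>R dyad x) - \<phi> B" for B
  have off: "D (B + dyad y) = D B" if "B \<in> hermitian" "y \<notin> cline x" for B y
    using dyad_increment_off_line[OF that] by (simp add: D_def)
  obtain w where w: "w \<notin> cline x" using not_line by blast
  have off_add: "y + w \<notin> cline x" "y - w \<notin> cline x" if "y \<in> cline x" for y
    using w that complex_vector.span_add_eq[of y "{x}" w] complex_vector.span_diff[of y "{x}" "y - w"]
    by auto
  have off_scale: "(1 / sqrt 2) *\<^sub>R y \<notin> cline x" if "y \<notin> cline x" for y
  proof
    assume "(1 / sqrt 2) *\<^sub>R y \<in> cline x"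
    then have "complex_of_real (sqrt 2) *\<^sub>C (1 / sqrt 2) *\<^sub>R y \<in> cline x"
      by (rule complex_vector.span_scale)
    then show False using that by (simp add: scaleR_scaleC scaleC_scaleC scaleC_one)
  qed
  let ?p = "(1 / sqrt 2) *\<^sub>R (z + w)" and ?m = "(1 / sqrt 2) *\<^sub>R (z - w)"
  have "D (A + dyad z) = D (A + dyad z + dyad w)" using A w by (simp add: off)
  also have "A + dyad z + dyad w = A + dyad ?p + dyad ?m"
    by (simp only: add.assoc dyad_add_rotated[of z w])
  also have "D \<dots> = D (A + dyad ?p)" using A True by (intro off off_scale off_add) auto
  also have "\<dots> = D A" using A True by (intro off off_scale off_add) auto
  finally show ?thesis by (simp add: D_def)
qed

lemma dyad_increment_add_scaled_dyad:
  assumes A: "A \<in> hermitian"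
  shows "\<phi> (A + c *\<^sub>R dyad z + t *\<^sub>R dyad x) - \<phi> (A + c *\<^sub>R dyad z) = \<phi> (A + t *\<^sub>R dyad x) - \<phi> A"
proof (cases "c \<ge> 0")
  case True
  then show ?thesis
    using dyad_increment_add_dyad[OF A, of "of_real (sqrt c) *\<^sub>C z" t x] by (simp add: dyad_sqrt)
next
  case False
  then have "dyad (of_real (sqrt (- c)) *\<^sub>C z) = - (c *\<^sub>R dyad z)" by (simp add: dyad_sqrt)
  then show ?thesis
    using A dyad_increment_add_dyad[of "A + c *\<^sub>R dyad z" "of_real (sqrt (- c)) *\<^sub>C z" t x] by simp
qed

text \<open>Since the increment along a line does not depend on the starting point on that line, the
parameter change is additive; it is monotone, so it is linear.\<close>

lemma dyad_increment_linear:
  assumes A: "A \<in> hermitian"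
  shows "\<phi> (A + t *\<^sub>R dyad x) = \<phi> A + t *\<^sub>R (\<phi> (A + dyad x) - \<phi> A)"
proof (cases "x = 0")
  case False
  obtain a f where a: "a \<noteq> 0" and f: "strict_mono f" "surj f" "f 0 = 0" "f 1 = (1::real)"
    "\<And>t. \<phi> (A + t *\<^sub>R dyad x) = \<phi> A + f t *\<^sub>R dyad a"
    using line_onto_line[OF A False] by blast
  have "f (s + t) = f s + f t" for s t
  proof -
    have "\<phi> (A + (s + t) *\<^sub>R dyad x) - \<phi> (A + s *\<^sub>R dyad x) = \<phi> (A + t *\<^sub>R dyad x) - \<phi> A"
      using dyad_increment_add_scaled_dyad[OF A, of s x t x] by (simp add: scaleR_add_left add.assoc)
    then have "f (s + t) *\<^sub>R dyad a - f s *\<^sub>R dyad a = f t *\<^sub>R dyad a" by (simp add: f)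
    then have "(f (s + t) - f s) *\<^sub>R dyad a = f t *\<^sub>R dyad a" by (simp only: scaleR_left_diff_distrib)
    then have "f (s + t) - f s = f t" by (metis a dyad_eq_0 scaleR_cancel_right)
    then show ?thesis by simp
  qed
  then have "f t = t * f 1" by (rule additive_mono_imp_linear[OF _ strict_mono_mono[OF f(1)]])
  moreover have "\<phi> (A + dyad x) - \<phi> A = dyad a" using f(5)[of 1] by (simp add: f(4))
  ultimately show ?thesis by (simp add: f(4) f(5)[of t])
qed simp

lemma increment_add_finite_rank:
  assumes "K \<in> finite_rank_hermitian" "A \<in> hermitian"
  shows "\<phi> (A + K + t *\<^sub>R dyad x) - \<phi> (A + K) = \<phi> (A + t *\<^sub>R dyad x) - \<phi> A"
  using assms(1)
proof (induction rule: finite_rank_induct)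
  case (add K r y)
  then show ?case
    using dyad_increment_add_scaled_dyad[of "A + K" r y t x] assms(2) by (simp add: add.assoc)
qed simp

end

locale zero_preserving_order_automorphism = order_automorphism_dim_ge_2 +
  assumes zero [simp]: "\<phi> 0 = 0"
begin

lemma add_scaled_dyad:
  assumes "K \<in> finite_rank_hermitian"
  shows "\<phi> (K + t *\<^sub>R dyad x) = \<phi> K + t *\<^sub>R \<phi> (dyad x)"
  using increment_add_finite_rank[OF assms, of 0 t x] dyad_increment_linear[of 0 t x]
  by (simp add: algebra_simps)

lemma add:
  assumes "K \<in> finite_rank_hermitian" "L \<in> finite_rank_hermitian"
  shows "\<phi> (K + L) = \<phi> K + \<phi> L"
  using assms(2)
proof (induction rule: finite_rank_induct)
  case (add L r x)
  then show ?case using add_scaled_dyad[of "K + L" r x] add_scaled_dyad[of L r x] assms(1)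
    by (simp add: add.assoc)
qed simp

lemma scaleR:
  assumes "K \<in> finite_rank_hermitian"
  shows "\<phi> (r *\<^sub>R K) = r *\<^sub>R \<phi> K"
  using assms
proof (induction rule: finite_rank_induct)
  case (add L s x)
  then show ?case using add_scaled_dyad[of "r *\<^sub>R L" "r * s" x] add_scaled_dyad[of L s x]
    by (simp add: scaleR_add_right)
qed simp

lemma diff:
  assumes "K \<in> finite_rank_hermitian" "L \<in> finite_rank_hermitian"
  shows "\<phi> (K - L) = \<phi> K - \<phi> L"
  using add[of "K - L" L] assms by simp

lemma dyad_image: "\<exists>y. \<phi> (dyad x) = dyad y"
  using dyad_step[of 0 x] by simp

end

section \<open>The phases of the image vectors\<close>

text \<open>The polarisation of \<open>dyad\<close>, real bilinear and symmetric: \<open>u \<mapsto> \<langle>u, y\<rangle> x + \<langle>u, x\<rangle> y\<close>. It has the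
relative phase of \<open>x\<close> and \<open>y\<close>, which the dyads of \<open>x\<close> and \<open>y\<close> alone have lost.\<close>

definition cross :: "'a :: complex_inner \<Rightarrow> 'a \<Rightarrow> ('a \<Rightarrow>\<^sub>L 'a)" where
  "cross x y = dyad (x + y) - dyad x - dyad y"

lemma cross_apply: "cross x y u = cinner u y *\<^sub>C x + cinner u x *\<^sub>C y"
  by (simp add: cross_def blinfun.bilinear_simps dyad_apply cinner_simps scaleC_add_left scaleC_add_right)

lemma cross_finite_rank [simp]: "cross x y \<in> finite_rank_hermitian"
  by (simp add: cross_def)

lemma dyad_add: "dyad (x + y) = dyad x + dyad y + cross x y"
  by (simp add: cross_def)

lemma cross_add_left: "cross (x + y) z = cross x z + cross y z"
  by (rule blinfun_eqI)
    (simp add: cross_apply blinfun.bilinear_simps cinner_simps scaleC_add_left scaleC_add_right)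

lemma cross_scaleR_left: "cross (r *\<^sub>R x) y = r *\<^sub>R cross x y"
  by (rule blinfun_eqI)
    (simp add: cross_apply blinfun.bilinear_simps cinner_simps scaleR_scaleC scaleC_scaleC
      scaleC_add_right mult_ac)

lemma cross_scaleC_self: "cross (c *\<^sub>C x) x = (2 * Re c) *\<^sub>R dyad x"
proof (rule blinfun_eqI)
  fix u
  have "cross (c *\<^sub>C x) x u = (c + cnj c) *\<^sub>C cinner u x *\<^sub>C x"
    by (simp add: cross_apply cinner_simps scaleC_scaleC scaleC_add_left distrib_left mult_ac)
  then show "cross (c *\<^sub>C x) x u = ((2 * Re c) *\<^sub>R dyad x) u"
    by (simp add: blinfun.bilinear_simps dyad_apply scaleR_scaleC complex_add_cnj)
qed

lemma dyad_scaleR: "dyad (r *\<^sub>R x) = r\<^sup>2 *\<^sub>R dyad x"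
  by (simp add: scaleR_scaleC dyad_scaleC)

lemma nonneg_quadratic_imp_linear_coeff_0:
  fixes p q :: real
  assumes "\<And>s. 0 \<le> s\<^sup>2 * p + s * q"
  shows "q = 0"
proof (rule ccontr)
  assume "q \<noteq> 0"
  (* small enough for the linear term to dominate the quadratic one *)
  define s where "s = - q / (\<bar>p\<bar> + 1)"
  have "s\<^sup>2 * p \<le> s\<^sup>2 * \<bar>p\<bar>" by (intro mult_left_mono) auto
  also have "\<dots> < s\<^sup>2 * (\<bar>p\<bar> + 1)"
    using \<open>q \<noteq> 0\<close> by (intro mult_strict_left_mono) (auto simp: s_def add_nonneg_eq_0_iff)
  also have "\<dots> = s * (s * (\<bar>p\<bar> + 1))" by (simp add: power2_eq_square)
  also have "s * (\<bar>p\<bar> + 1) = - q" by (simp add: s_def add_nonneg_eq_0_iff)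
  finally show False using assms[of s] by simp
qed

text \<open>The family in the assumption is the image of \<open>dyad (e + s *\<^sub>R x)\<close>. Evaluated at vectors
orthogonal to \<open>f\<close>, the form is a nonnegative polynomial in \<open>s\<close> without constant term, so its
linear coefficient vanishes; at vectors orthogonal to \<open>a\<close> it is affine in \<open>s\<close>. This gives
\<open>\<bar>\<langle>u, c\<rangle>\<bar> = \<bar>\<langle>u, a\<rangle>\<bar>\<close> and \<open>\<bar>\<langle>u, c\<rangle>\<bar> = \<bar>\<langle>u, f\<rangle>\<bar>\<close> respectively, so \<open>c\<close> is a combination of \<open>a\<close> and
\<open>f\<close> with unimodular coefficients.\<close>

lemma dyad_between_lines:
  assumes a: "a \<notin> cline f" and f: "f \<notin> cline a"
    and nonneg: "\<And>s. 0 \<preceq> dyad f + s\<^sup>2 *\<^sub>R dyad a + s *\<^sub>R (dyad c - dyad a - dyad f)"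
  shows "\<exists>\<mu>. cmod \<mu> = 1 \<and> dyad c = dyad (\<mu> *\<^sub>C a + f)"
proof -
  have form: "0 \<le> (cmod (cinner u f))\<^sup>2 + s\<^sup>2 * (cmod (cinner u a))\<^sup>2
      + s * ((cmod (cinner u c))\<^sup>2 - (cmod (cinner u a))\<^sup>2 - (cmod (cinner u f))\<^sup>2)" for s u
    using nonneg[of s] unfolding qle_def
    by (auto simp: blinfun.bilinear_simps inner_simps dyad_form dest: spec[of _ u])
  have off_f: "cmod (cinner u c) = cmod (cinner u a)" if "cinner u f = 0" for u
    using nonneg_quadratic_imp_linear_coeff_0[of "(cmod (cinner u a))\<^sup>2"
        "(cmod (cinner u c))\<^sup>2 - (cmod (cinner u a))\<^sup>2"] form[of u] that by simp
  have off_a: "cmod (cinner u c) = cmod (cinner u f)" if "cinner u a = 0" for u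
  proof -
    have "(cmod (cinner u c))\<^sup>2 - (cmod (cinner u f))\<^sup>2 = 0"
    proof (rule ccontr)
      let ?q = "(cmod (cinner u c))\<^sup>2 - (cmod (cinner u f))\<^sup>2"
      assume "?q \<noteq> 0"
      then show False using form[of u "- ((cmod (cinner u f))\<^sup>2 + 1) / ?q"] that by simp
    qed
    then show ?thesis by simp
  qed
  obtain v where v: "cinner v f = 0" "cinner v a \<noteq> 0" using orthogonal_test_vector[OF a] by blast
  obtain w where w: "cinner w a = 0" "cinner w f \<noteq> 0" using orthogonal_test_vector[OF f] by blast
  define \<alpha> where "\<alpha> = cnj (cinner v c / cinner v a)"
  define \<beta> where "\<beta> = cnj (cinner w c / cinner w f)"
  have \<alpha>: "cmod \<alpha> = 1" using v off_f[of v] by (simp add: \<alpha>_def norm_divide)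
  have \<beta>: "cmod \<beta> = 1" using w off_a[of w] by (simp add: \<beta>_def norm_divide)
  have "c = \<alpha> *\<^sub>C a + \<beta> *\<^sub>C f"
  proof (rule cinner_eqI)
    fix u
    (* v and w act as a dual basis, so this difference is orthogonal to a and to f *)
    define u' where "u' = u - (cinner u a / cinner v a) *\<^sub>C v - (cinner u f / cinner w f) *\<^sub>C w"
    have "cinner u' f = 0" "cinner u' a = 0" using v w by (simp_all add: u'_def cinner_simps)
    then have "cinner u' c = 0" using off_f[of u'] by simp
    then have "cinner u c = cnj \<alpha> * cinner u a + cnj \<beta> * cinner u f"
      by (simp add: u'_def cinner_simps \<alpha>_def \<beta>_def field_simps)
    then have "cinner u c = cinner u (\<alpha> *\<^sub>C a + \<beta> *\<^sub>C f)" by (simp add: cinner_simps)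
    then show "cinner c u = cinner (\<alpha> *\<^sub>C a + \<beta> *\<^sub>C f) u" by (metis cinner_commute)
  qed
  also have "\<dots> = \<beta> *\<^sub>C ((\<alpha> / \<beta>) *\<^sub>C a + f)"
    using \<beta> by (auto simp: scaleC_add_right scaleC_scaleC)
  finally have "dyad c = dyad ((\<alpha> / \<beta>) *\<^sub>C a + f)" by (simp add: dyad_scaleC \<beta>)
  then show ?thesis using \<alpha> \<beta> by (intro exI[of _ "\<alpha> / \<beta>"]) (simp add: norm_divide)
qed

lemma subspace_Un_eq_UNIV:
  assumes "subspace U" "subspace V" "U \<union> V = UNIV"
  shows "U = UNIV \<or> V = UNIV"
proof (rule ccontr)
  assume "\<not> ?thesis"
  then obtain u v where uv: "u \<notin> U" "v \<notin> V" by blast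
  then have "u \<in> V" "v \<in> U" using assms(3) by blast+
  have "u + v \<in> U \<or> u + v \<in> V" using assms(3) by blast
  then show False
    using uv \<open>u \<in> V\<close> \<open>v \<in> U\<close> subspace_diff[OF assms(1), of "u + v" v] subspace_diff[OF assms(2), of "u + v" u]
    by auto
qed

section \<open>Construction of the implementing map\<close>

locale reference_vector = zero_preserving_order_automorphism \<phi>
  for \<phi> :: "('a :: complex_inner \<Rightarrow>\<^sub>L 'a) \<Rightarrow> ('a \<Rightarrow>\<^sub>L 'a)" +
  fixes e f :: 'a
  assumes e: "e \<noteq> 0" and f: "\<phi> (dyad e) = dyad f"
begin

text \<open>If \<open>\<phi>\<close> is \<open>A \<mapsto> T A T\<^sup>*\<close> with \<open>T e = f\<close>, then \<open>\<phi> (cross x e) = cross (T x) f\<close>, and for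
\<open>T (\<i> x) = k T x\<close> the combination below cancels the component of \<open>\<phi> (cross x e) f\<close> along \<open>f\<close> and
leaves \<open>T x\<close>. Here \<open>k = \<i>\<close> is the linear and \<open>k = - \<i>\<close> the conjugate-linear case. The formula is
real linear in \<open>x\<close> by construction, so that no choice of phases is made vector by vector.\<close>

definition lift :: "complex \<Rightarrow> 'a \<Rightarrow> 'a" where
  "lift k x = (1 / (2 * (norm f)\<^sup>2)) *\<^sub>R
     (\<phi> (cross x e) f - k *\<^sub>C \<phi> (cross (\<i> *\<^sub>C x) e) f)"

lemma f_nonzero: "f \<noteq> 0"
  using eq_iff[of "dyad e" 0] e f by auto

lemma lift_add: "lift k (x + y) = lift k x + lift k y"
  by (simp add: lift_def cross_add_left scaleC_add_right add blinfun.add_left algebra_simps)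

lemma lift_scaleR: "lift k (r *\<^sub>R x) = r *\<^sub>R lift k x"
  by (simp add: lift_def cross_scaleR_left scaleC_scaleR scaleR blinfun.scaleR_left
      flip: scaleR_right_diff_distrib)

lemma lift_i:
  assumes "k * k = - 1"
  shows "lift k (\<i> *\<^sub>C x) = k *\<^sub>C lift k x"
proof -
  have "\<i> *\<^sub>C \<i> *\<^sub>C x = (- 1) *\<^sub>R x" by (simp add: scaleC_scaleC scaleR_scaleC)
  then have "lift k (\<i> *\<^sub>C x) = (1 / (2 * (norm f)\<^sup>2)) *\<^sub>R
      (\<phi> (cross (\<i> *\<^sub>C x) e) f + k *\<^sub>C \<phi> (cross x e) f)"
    by (simp only: lift_def cross_scaleR_left scaleR cross_finite_rank blinfun.scaleR_left scaleC_scaleR)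
      simp
  also have "\<dots> = k *\<^sub>C lift k x"
    using assms by (simp add: lift_def scaleC_scaleR complex_vector.scale_right_diff_distrib
        scaleC_scaleC scaleC_one)
  finally show ?thesis .
qed

lemma image_off_reference:
  assumes x: "x \<notin> cline e" and a: "\<phi> (dyad x) = dyad a"
  shows "a \<notin> cline f" "f \<notin> cline a"
proof -
  show a_off: "a \<notin> cline f"
  proof
    assume "a \<in> cline f"
    then obtain r where "dyad a = r *\<^sub>R dyad f" using dyad_of_cline by blast
    then have "\<phi> (dyad x) = \<phi> (r *\<^sub>R dyad e)" using scaleR[of "dyad e" r] a f by simp
    then have "dyad x = r *\<^sub>R dyad e" by (simp add: eq_iff)
    then show False using dyad_le_imp_cline[of x r e] x by simp
  qed
  show "f \<notin> cline a" using a_off cline_sym f_nonzero by blast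
qed

text \<open>The phase of \<open>a\<close> is chosen by the second equation. It exists because the images of
\<open>dyad (s *\<^sub>R x + e)\<close> are positive for all real \<open>s\<close>.\<close>

lemma cross_image:
  assumes x: "x \<notin> cline e"
  obtains a where "\<phi> (dyad x) = dyad a" "\<phi> (cross x e) = cross a f"
proof -
  obtain a where a: "\<phi> (dyad x) = dyad a" using dyad_image by blast
  obtain c where c: "\<phi> (dyad (x + e)) = dyad c" using dyad_image by blast
  have M: "\<phi> (cross x e) = dyad c - dyad a - dyad f"
    by (simp add: cross_def diff a c f)
  have "0 \<preceq> dyad f + s\<^sup>2 *\<^sub>R dyad a + s *\<^sub>R (dyad c - dyad a - dyad f)" for s
  proof -
    have "\<phi> (dyad (s *\<^sub>R x + e)) = \<phi> (s\<^sup>2 *\<^sub>R dyad x + dyad e + s *\<^sub>R cross x e)"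
      by (simp only: dyad_add dyad_scaleR cross_scaleR_left)
    also have "\<dots> = dyad f + s\<^sup>2 *\<^sub>R dyad a + s *\<^sub>R (dyad c - dyad a - dyad f)"
      by (simp add: add scaleR a f M)
    finally show ?thesis using dyad_image[of "s *\<^sub>R x + e"] by (metis dyad_nonneg)
  qed
  then obtain \<mu> where \<mu>: "cmod \<mu> = 1" "dyad c = dyad (\<mu> *\<^sub>C a + f)"
    using dyad_between_lines[OF image_off_reference[OF x a]] by blast
  show ?thesis
  proof (rule that[of "\<mu> *\<^sub>C a"])
    show "\<phi> (dyad x) = dyad (\<mu> *\<^sub>C a)" using \<mu>(1) by (simp add: a dyad_scaleC)
    then show "\<phi> (cross x e) = cross (\<mu> *\<^sub>C a) f" by (simp add: M \<mu>(2) cross_def[of "\<mu> *\<^sub>C a"] a)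
  qed
qed

text \<open>By the preceding lemma, \<open>x\<close> and \<open>\<i> x\<close> correspond to vectors \<open>a\<close> and \<open>\<eta> a\<close> with \<open>\<eta>\<close> unimodular.
The images of \<open>dyad (x + \<i> x + e)\<close> and \<open>dyad (x - \<i> x + e)\<close> are positive, which bounds the real
part of \<open>\<eta>\<close> from both sides by zero.\<close>

lemma cross_image_pair:
  assumes x: "x \<notin> cline e"
  obtains a \<eta> where "\<phi> (dyad x) = dyad a" "\<phi> (cross x e) = cross a f"
    "\<phi> (cross (\<i> *\<^sub>C x) e) = cross (\<eta> *\<^sub>C a) f" "\<eta> = \<i> \<or> \<eta> = - \<i>"
proof -
  obtain a where a: "\<phi> (dyad x) = dyad a" "\<phi> (cross x e) = cross a f"
    using cross_image[OF x] .
  have "\<i> *\<^sub>C x \<notin> cline e"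
  proof
    assume "\<i> *\<^sub>C x \<in> cline e"
    then have "(- \<i>) *\<^sub>C \<i> *\<^sub>C x \<in> cline e" by (rule complex_vector.span_scale)
    then show False using x by (simp add: scaleC_scaleC scaleC_one)
  qed
  then obtain b where b: "\<phi> (dyad (\<i> *\<^sub>C x)) = dyad b" "\<phi> (cross (\<i> *\<^sub>C x) e) = cross b f"
    using cross_image by blast
  have "dyad b = dyad a" using a(1) b(1) by (simp add: dyad_scaleC)
  then obtain \<eta> where \<eta>: "cmod \<eta> = 1" "b = \<eta> *\<^sub>C a" using dyad_eq_iff by blast
  have Re_le: "s * Re \<eta> \<le> 0" if s: "s * s = 1" for s :: real
  proof -
    define c where "c = 1 + of_real s * \<i>"
    define d where "d = 1 + of_real s * \<eta>"
    (* d a + f is the vector that would correspond to c x + e; the moduli of c and d differ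
       unless the real part of eta is zero *)
    have c: "c *\<^sub>C x = x + s *\<^sub>R \<i> *\<^sub>C x"
      by (simp add: c_def scaleC_add_left scaleC_one scaleR_scaleC scaleC_scaleC)
    have d: "d *\<^sub>C a = a + s *\<^sub>R b"
      by (simp add: d_def \<eta>(2) scaleC_add_left scaleC_one scaleR_scaleC scaleC_scaleC)
    have "(cmod c)\<^sup>2 = 2" using s by (simp add: c_def cmod_power2) (simp add: power2_eq_square)
    then have "dyad (c *\<^sub>C x + e) = 2 *\<^sub>R dyad x + dyad e + (cross x e + s *\<^sub>R cross (\<i> *\<^sub>C x) e)"
      unfolding dyad_add dyad_scaleC by (simp add: c cross_add_left cross_scaleR_left)
    then have "\<phi> (dyad (c *\<^sub>C x + e)) = 2 *\<^sub>R dyad a + dyad f + (cross a f + s *\<^sub>R cross b f)"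
      by (simp add: add scaleR a b f)
    also have "\<dots> = dyad (d *\<^sub>C a + f) + (2 - (cmod d)\<^sup>2) *\<^sub>R dyad a"
      unfolding dyad_add dyad_scaleC
      by (simp add: d cross_add_left cross_scaleR_left scaleR_left_diff_distrib)
    finally have nonneg: "0 \<preceq> dyad (d *\<^sub>C a + f) + (2 - (cmod d)\<^sup>2) *\<^sub>R dyad a"
      using dyad_image by (metis dyad_nonneg)
    have "a \<notin> cline (d *\<^sub>C a + f)"
    proof
      assume "a \<in> cline (d *\<^sub>C a + f)"
      moreover have "a \<noteq> 0" using image_off_reference(1)[OF x a(1)] complex_vector.span_zero by metis
      ultimately have "d *\<^sub>C a + f \<in> cline a" by (rule cline_sym)
      then have "d *\<^sub>C a + f - d *\<^sub>C a \<in> cline a" by (rule complex_vector.span_diff) simp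
      then show False using image_off_reference(2)[OF x a(1)] by simp
    qed
    then obtain w where w: "cinner w (d *\<^sub>C a + f) = 0" "cinner w a \<noteq> 0"
      using orthogonal_test_vector by blast
    have "0 \<le> (2 - (cmod d)\<^sup>2) * (cmod (cinner w a))\<^sup>2"
      using nonneg w(1) unfolding qle_def
      by (auto simp: blinfun.bilinear_simps inner_simps dyad_form dest: spec[of _ w])
    then have "(cmod d)\<^sup>2 \<le> 2" using w(2) by (simp add: zero_le_mult_iff)
    moreover have "(cmod d)\<^sup>2 = 1 + 2 * (s * Re \<eta>) + s * s * (cmod \<eta>)\<^sup>2"
      unfolding cmod_power2 d_def by (simp add: power2_eq_square algebra_simps)
    ultimately show ?thesis using s \<eta>(1) by simp
  qed
  have "Re \<eta> = 0" using Re_le[of 1] Re_le[of "-1"] by simp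
  then have "(Im \<eta>)\<^sup>2 = 1" using \<eta>(1) cmod_power2[of \<eta>] by simp
  then have "\<eta> = \<i> \<or> \<eta> = - \<i>" using \<open>Re \<eta> = 0\<close> by (simp add: power2_eq_1_iff complex_eq_iff)
  with a b(2) \<eta>(2) show ?thesis using that by blast
qed

lemma lift_reference:
  assumes "k = \<i> \<or> k = - \<i>" and "x \<in> cline e"
  shows "lift k x \<in> cline f" "\<phi> (dyad x) = dyad (lift k x)"
proof -
  obtain c where c: "x = c *\<^sub>C e" using assms(2) by (rule clineE)
  have dff: "dyad f f = (norm f)\<^sup>2 *\<^sub>R f" by (simp add: dyad_apply cinner_self scaleR_scaleC)
  have "\<phi> (cross (d *\<^sub>C e) e) f = (2 * Re d * (norm f)\<^sup>2) *\<^sub>R f" for d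
    by (simp add: cross_scaleC_self scaleR f blinfun.scaleR_left dff)
  then have "lift k x = (1 / (2 * (norm f)\<^sup>2)) *\<^sub>R
      ((2 * Re c * (norm f)\<^sup>2) *\<^sub>R f - k *\<^sub>C (2 * Re (\<i> * c) * (norm f)\<^sup>2) *\<^sub>R f)"
    by (simp only: lift_def c scaleC_scaleC)
  also have "\<dots> = (of_real (Re c) + of_real (Im c) * k) *\<^sub>C f"
    using f_nonzero
    by (simp add: scaleR_right_diff_distrib scaleR_scaleC scaleC_scaleC scaleC_add_left field_simps)
  finally have l: "lift k x = (of_real (Re c) + of_real (Im c) * k) *\<^sub>C f" .
  then show "lift k x \<in> cline f" by simp
  have "cmod (of_real (Re c) + of_real (Im c) * k) = cmod c"
    using assms(1) by (auto simp: cmod_def)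
  moreover have "\<phi> (dyad x) = (cmod c)\<^sup>2 *\<^sub>R dyad f" by (simp add: c dyad_scaleC scaleR f)
  ultimately show "\<phi> (dyad x) = dyad (lift k x)" by (simp add: l dyad_scaleC)
qed

text \<open>On each plane through \<open>e\<close> the map is either linear or conjugate-linear; the candidate for the
wrong alternative collapses to multiples of \<open>f\<close>.\<close>

lemma lift_dichotomy:
  "\<exists>k. (k = \<i> \<or> k = - \<i>) \<and> \<phi> (dyad x) = dyad (lift k x) \<and> lift (- k) x \<in> cline f"
proof (cases "x \<in> cline e")
  case True
  then show ?thesis using lift_reference[of \<i> x] lift_reference[of "- \<i>" x] by auto
next
  case False
  then obtain a k where a: "\<phi> (dyad x) = dyad a" "\<phi> (cross x e) = cross a f"
    "\<phi> (cross (\<i> *\<^sub>C x) e) = cross (k *\<^sub>C a) f" and k: "k = \<i> \<or> k = - \<i>"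
    using cross_image_pair by metis
  have kk: "k * k = - 1" "k * cnj k = 1" using k by auto
  define n where "n = (norm f)\<^sup>2"
  have n: "n \<noteq> 0" using f_nonzero by (simp add: n_def)
  have ff: "cinner f f = of_real n" by (simp add: cinner_self n_def)
  have 1: "\<phi> (cross x e) f = n *\<^sub>R a + cinner f a *\<^sub>C f"
    by (simp add: a cross_apply ff scaleR_scaleC)
  have 2: "k *\<^sub>C \<phi> (cross (\<i> *\<^sub>C x) e) f = - (n *\<^sub>R a) + cinner f a *\<^sub>C f"
  proof -
    have "k *\<^sub>C \<phi> (cross (\<i> *\<^sub>C x) e) f
        = ((k * k) * of_real n) *\<^sub>C a + ((k * cnj k) * cinner f a) *\<^sub>C f"
      by (simp add: a cross_apply ff scaleC_add_right scaleC_scaleC cinner_scaleC_right mult_ac)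
    then show ?thesis by (simp add: kk scaleR_scaleC)
  qed
  have "lift k x = (1 / (2 * n)) *\<^sub>R (2 * n) *\<^sub>R a"
    unfolding lift_def n_def[symmetric] 1 2 by (simp add: scaleR_add_left[symmetric])
  then have "lift k x = a" using n by simp
  moreover have "lift (- k) x = (1 / (2 * n)) *\<^sub>R (2 *\<^sub>R cinner f a *\<^sub>C f)"
    unfolding lift_def n_def[symmetric] complex_vector.scale_minus_left 1 2 by (simp add: scaleR_2)
  then have "lift (- k) x \<in> cline f"
    by (simp add: scaleR_scaleC scaleC_scaleC)
  ultimately show ?thesis using a(1) k by auto
qed

text \<open>The vectors at which one of the two candidates collapses form a real subspace, and two proper
subspaces do not cover the space. Hence one candidate collapses everywhere, and the other one is
the map sought.\<close>

lemma lift_exists: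
  "\<exists>k. (k = \<i> \<or> k = - \<i>) \<and> (\<forall>x. \<phi> (dyad x) = dyad (lift k x))"
proof -
  have "r *\<^sub>R y \<in> cline f" if "y \<in> cline f" for r y
    using that by (simp add: scaleR_scaleC complex_vector.span_scale)
  then have sub: "subspace {x. lift k x \<in> cline f}" for k
    using lift_scaleR[of k 0 0]
    by (auto simp: subspace_def lift_add lift_scaleR complex_vector.span_zero
        intro: complex_vector.span_add)
  have "{x. lift (- \<i>) x \<in> cline f} \<union> {x. lift \<i> x \<in> cline f} = UNIV"
    using lift_dichotomy by fastforce
  from subspace_Un_eq_UNIV[OF sub sub this]
  obtain k where k: "k = \<i> \<or> k = - \<i>" and all: "\<And>x. lift (- k) x \<in> cline f"
    by (metis (mono_tags, lifting) UNIV_I mem_Collect_eq minus_minus)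
  have "\<phi> (dyad x) = dyad (lift k x)" for x
  proof (cases "x \<in> cline e")
    case True
    then show ?thesis using lift_reference k by blast
  next
    case False
    obtain l where l: "l = \<i> \<or> l = - \<i>" "\<phi> (dyad x) = dyad (lift l x)" using lift_dichotomy by blast
    have "l \<noteq> - k" using image_off_reference(1)[OF False l(2)] all by metis
    then have "l = k" using l(1) k by auto
    then show ?thesis using l by simp
  qed
  then show ?thesis using k by blast
qed

end

section \<open>Boundedness and invertibility\<close>

lemma norm_le_of_dyad_le:
  assumes "dyad y \<preceq> B"
  shows "(norm y)\<^sup>2 \<le> norm B"
proof (cases "y = 0")
  case False
  have "(norm y)\<^sup>2 * (norm y)\<^sup>2 = inner (dyad y y) y"
    unfolding dyad_form cinner_self norm_of_real by (simp add: power2_eq_square)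
  also have "\<dots> \<le> inner (B y) y" using assms by (simp add: qle_def)
  also have "\<dots> \<le> norm (B y) * norm y" by (rule norm_cauchy_schwarz)
  also have "\<dots> \<le> norm B * norm y * norm y" by (intro mult_right_mono norm_blinfun) auto
  finally show ?thesis using False by (simp add: power2_eq_square)
qed simp

lemma dyad_le_id:
  assumes "norm x \<le> 1"
  shows "dyad x \<preceq> id_blinfun"
  unfolding qle_def
proof
  fix u
  have "cmod (cinner u x) \<le> norm u * 1"
    using cmod_cinner_le[of u x] assms by (meson mult_left_mono norm_ge_zero order_trans)
  then have "(cmod (cinner u x))\<^sup>2 \<le> (norm u)\<^sup>2" by (intro power_mono) auto
  then show "inner (dyad x u) u \<le> inner (id_blinfun u) u"
    by (simp add: dyad_form power2_norm_eq_inner)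
qed

text \<open>Homogeneity extends a bound from the unit ball of \<open>q\<close>. It is applied to \<open>x \<mapsto> \<parallel>T x\<parallel>\<close> and the norm, in
both orders, to bound \<open>T\<close> and its inverse.\<close>

lemma norm_le_scale:
  fixes p q :: "'a :: real_vector \<Rightarrow> real"
  assumes p: "\<And>r x. p (r *\<^sub>R x) = \<bar>r\<bar> * p x" and q: "\<And>r x. q (r *\<^sub>R x) = \<bar>r\<bar> * q x"
    and "q x > 0" and unit: "\<And>x. q x \<le> 1 \<Longrightarrow> p x \<le> C"
  shows "p x \<le> q x * C"
proof -
  have "p ((1 / q x) *\<^sub>R x) \<le> C" using assms(3) by (intro unit) (simp add: q)
  then show ?thesis using assms(3) by (simp add: p field_simps)
qed

text \<open>The estimate \<open>dyad x \<preceq> 1\<close> for \<open>\<parallel>x\<parallel> \<le> 1\<close> is mapped to \<open>dyad (T x) \<preceq> \<phi> 1\<close>, which bounds \<open>T\<close>; the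
preimage of the identity bounds the inverse in the same way. Surjectivity comes from the fact that
the inverse of \<open>\<phi>\<close> also preserves rank one.\<close>

lemma (in zero_preserving_order_automorphism) implementing_operator:
  obtains T :: "'a \<Rightarrow> 'a"
  where "invertible_op T" "bounded_clinear T \<or> bounded_antilinear T"
    "\<And>x. \<phi> (dyad x) = dyad (T x)"
proof -
  obtain e :: 'a where e: "e \<noteq> 0" using not_line[of 0] complex_vector.span_zero by metis
  obtain f where f: "\<phi> (dyad e) = dyad f" using dyad_image by blast
  interpret reference_vector \<phi> e f by unfold_locales (fact e, fact f)
  obtain k where k: "k = \<i> \<or> k = - \<i>" and image: "\<And>x. \<phi> (dyad x) = dyad (lift k x)"
    using lift_exists by blast
  define T where "T = lift k"
  have T: "\<phi> (dyad x) = dyad (T x)" for x by (simp add: T_def image)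
  have T_add: "T (x + y) = T x + T y" and T_scaleR: "T (r *\<^sub>R x) = r *\<^sub>R T x" for x y r
    by (simp_all add: T_def lift_add lift_scaleR)
  have T_scaleC: "T (c *\<^sub>C x) = (of_real (Re c) + of_real (Im c) * k) *\<^sub>C T x" for c x
  proof -
    have "c *\<^sub>C x = Re c *\<^sub>R x + Im c *\<^sub>R \<i> *\<^sub>C x"
      by (simp add: scaleR_scaleC scaleC_scaleC complex_eq mult.commute flip: scaleC_add_left)
    moreover have "T (\<i> *\<^sub>C x) = k *\<^sub>C T x" unfolding T_def using k by (intro lift_i) auto
    ultimately have "T (c *\<^sub>C x) = Re c *\<^sub>R T x + Im c *\<^sub>R k *\<^sub>C T x"
      by (simp only: T_add T_scaleR)
    then show ?thesis by (simp add: scaleR_scaleC scaleC_scaleC scaleC_add_left)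
  qed
  obtain J where J: "J \<in> hermitian" "\<phi> J = id_blinfun" using onto[of id_blinfun] by auto
  have upper_unit: "norm (T x) \<le> sqrt (norm (\<phi> id_blinfun))" if "norm x \<le> 1" for x
  proof -
    have "dyad (T x) \<preceq> \<phi> id_blinfun"
      unfolding T[symmetric] using dyad_le_id[OF that] by (simp add: le_iff)
    then show ?thesis by (intro real_le_rsqrt norm_le_of_dyad_le)
  qed
  have lower_unit: "norm x \<le> sqrt (norm J)" if "norm (T x) \<le> 1" for x
  proof -
    have "\<phi> (dyad x) \<preceq> \<phi> J" unfolding T J by (rule dyad_le_id[OF that])
    then have "dyad x \<preceq> J" using le_iff[of "dyad x" J] J(1) by simp
    then show ?thesis by (intro real_le_rsqrt norm_le_of_dyad_le)
  qed
  have T_nonzero: "T x \<noteq> 0" if "x \<noteq> 0" for x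
  proof -
    have "\<phi> (dyad x) \<noteq> \<phi> 0" using that by (subst eq_iff) auto
    then show ?thesis by (auto simp: T)
  qed
  have T_0: "T 0 = 0" using T_scaleR[of 0 0] by simp
  have upper: "norm (T x) \<le> norm x * sqrt (norm (\<phi> id_blinfun))" for x
  proof (cases "x = 0")
    case False
    then show ?thesis
      by (intro norm_le_scale[of "\<lambda>x. norm (T x)" norm]) (auto simp: T_scaleR upper_unit)
  qed (simp add: T_0)
  have lower: "norm x \<le> norm (T x) * sqrt (norm J)" for x
  proof (cases "x = 0")
    case False
    then show ?thesis
      by (intro norm_le_scale[of norm "\<lambda>x. norm (T x)"]) (auto simp: T_scaleR lower_unit T_nonzero)
  qed simp
  have bounded: "bounded_linear T"
    by (rule bounded_linear_intro[OF T_add T_scaleR upper])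
  have "surj T"
  proof -
    have "\<exists>x. T x = y" for y
    proof -
      interpret inv: order_automorphism "inv_into hermitian \<phi>" by (rule inverse)
      have inv_0: "inv_into hermitian \<phi> 0 = 0"
        using bij_betw_inv_into_left[OF bij, of 0] by simp
      obtain x where "inv_into hermitian \<phi> (dyad y) = dyad x"
        using inv.dyad_step[of 0 y] inv_0 by auto
      then have "dyad y = dyad (T x)"
        using bij_betw_inv_into_right[OF bij, of "dyad y"] by (simp add: T)
      then obtain c where c: "y = c *\<^sub>C T x" using dyad_eq_iff by blast
      (* the phase that T turns into c *)
      define d where "d = (if k = \<i> then c else cnj c)"
      have "of_real (Re d) + of_real (Im d) * k = c"
        using k by (auto simp: d_def complex_eq_iff)
      then have "T (d *\<^sub>C x) = y" by (simp only: T_scaleC c)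
      then show ?thesis by blast
    qed
    then show ?thesis by (metis surjI)
  qed
  moreover have "inj T"
  proof (rule injI)
    fix x y assume "T x = T y"
    then have "T (x - y) = 0" using bounded by (simp add: linear_simps)
    then show "x = y" using T_nonzero[of "x - y"] by auto
  qed
  ultimately have "bij T" by (simp add: bij_def)
  have inv: "T (inv T y) = y" for y using \<open>surj T\<close> by (rule surj_f_inv_f)
  have "bounded_linear (inv T)"
  proof (rule bounded_linear_intro)
    show "inv T (x + y) = inv T x + inv T y" for x y
      by (rule injD[OF \<open>inj T\<close>]) (simp add: T_add inv)
    show "inv T (r *\<^sub>R x) = r *\<^sub>R inv T x" for r x
      by (rule injD[OF \<open>inj T\<close>]) (simp add: T_scaleR inv)
    show "norm (inv T y) \<le> norm y * sqrt (norm J)" for y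
      using lower[of "inv T y"] by (simp add: inv)
  qed
  then have "invertible_op T" using \<open>bij T\<close> by (simp add: invertible_op_def)
  moreover have "bounded_clinear T \<or> bounded_antilinear T"
    using k
  proof
    assume "k = \<i>"
    then have "T (c *\<^sub>C x) = c *\<^sub>C T x" for c x
      using complex_eq[of c] by (simp add: T_scaleC mult.commute)
    then show ?thesis using bounded by (simp add: bounded_clinear_def)
  next
    assume "k = - \<i>"
    moreover have "cnj c = of_real (Re c) + of_real (Im c) * - \<i>" for c
      by (simp add: complex_eq_iff)
    ultimately have "T (c *\<^sub>C x) = cnj c *\<^sub>C T x" for c x
      by (simp only: T_scaleC)
    then show ?thesis using bounded by (simp add: bounded_antilinear_def)
  qed
  ultimately show ?thesis using T that by blast
qed

section \<open>Congruence by an operator and its adjoint\<close>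

text \<open>Both kinds of adjoint coincide with the real one; carrying the real identity along allows the
linear and the conjugate-linear case to be treated together.\<close>

definition adjoint_pair :: "('a :: complex_inner \<Rightarrow> 'a) \<Rightarrow> ('a \<Rightarrow> 'a) \<Rightarrow> bool" where
  "adjoint_pair T S \<longleftrightarrow> (bounded_clinear T \<and> cadjoint T = S \<and> bounded_clinear S \<or>
     bounded_antilinear T \<and> antilinear_adjoint T = S \<and> bounded_antilinear S) \<and>
     (\<forall>x y. inner (T x) y = inner x (S y))"

lemma adjoint_pair_exists:
  fixes T :: "'a :: complex_hilbert \<Rightarrow> 'a"
  assumes "bounded_clinear T \<or> bounded_antilinear T"
  obtains S where "adjoint_pair T S"
proof -
  have "bounded_linear T" using assms by (auto simp: bounded_clinear_def bounded_antilinear_def)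
  then obtain S where S: "bounded_linear S" "\<And>x y. inner (T x) y = inner x (S y)"
    using bounded_linear_adjoint_exists by blast
  show ?thesis
    using assms cadjoint_eq[OF _ S] antilinear_adjoint_eq[OF _ S] S that[of S]
    by (auto simp: adjoint_pair_def)
qed

lemma adjoint_pair_bounded:
  assumes "adjoint_pair T S"
  shows "bounded_linear T" "bounded_linear S"
  using assms by (auto simp: adjoint_pair_def bounded_clinear_def bounded_antilinear_def)

definition congruence :: "('a :: complex_inner \<Rightarrow> 'a) \<Rightarrow> ('a \<Rightarrow> 'a) \<Rightarrow> ('a \<Rightarrow>\<^sub>L 'a) \<Rightarrow> ('a \<Rightarrow>\<^sub>L 'a)" where
  "congruence T S A = Blinfun T o\<^sub>L A o\<^sub>L Blinfun S"

lemma congruence_apply: "adjoint_pair T S \<Longrightarrow> congruence T S A x = T (A (S x))"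
  by (simp add: congruence_def bounded_linear_Blinfun_apply adjoint_pair_bounded)

lemma congruence_add: "congruence T S (A + B) = congruence T S A + congruence T S B"
  by (rule blinfun_eqI) (simp add: congruence_def blinfun.bilinear_simps)

lemma congruence_form:
  assumes "adjoint_pair T S"
  shows "inner (congruence T S A x) y = inner (A (S x)) (S y)"
  using assms by (auto simp: congruence_apply) (simp add: adjoint_pair_def)

lemma congruence_hermitian:
  assumes TS: "adjoint_pair T S" and A: "A \<in> hermitian"
  shows "congruence T S A \<in> hermitian"
proof -
  have "congruence T S A (c *\<^sub>C x) = c *\<^sub>C congruence T S A x" for c x
    using TS A by (auto simp: congruence_apply adjoint_pair_def bounded_clinear_def
        bounded_antilinear_def hermitian_scaleC)
  moreover have "inner (congruence T S A x) y = inner x (congruence T S A y)" for x y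
    using congruence_form[OF TS, of A] hermitian_inner[OF A] by (metis inner_commute)
  ultimately have "cinner (congruence T S A x) y = cinner x (congruence T S A y)" for x y
    by (rule clinear_adjoint_cinner)
  then show ?thesis by (simp add: hermitian_def)
qed

text \<open>In the conjugate-linear case the two inner products are conjugate to each other, and the modulus
hides the difference.\<close>

lemma adjoint_pair_cinner:
  assumes "adjoint_pair T S"
  shows "cmod (cinner u (T x)) = cmod (cinner (S u) x)"
proof -
  have inner: "inner (T x) y = inner x (S y)" for x y using assms by (simp add: adjoint_pair_def)
  have "bounded_clinear T \<or> bounded_antilinear T" using assms by (auto simp: adjoint_pair_def)
  then show ?thesis
  proof
    assume "bounded_clinear T"
    then have "cinner (T x) u = cinner x (S u)"
      using inner by (intro clinear_adjoint_cinner) (auto simp: bounded_clinear_def)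
    then show ?thesis by (metis cmod_cinner_commute)
  next
    assume "bounded_antilinear T"
    then have "cinner (T x) u = cinner (S u) x"
      using inner by (intro antilinear_adjoint_cinner) (auto simp: bounded_antilinear_def)
    then show ?thesis by (metis cmod_cinner_commute)
  qed
qed

text \<open>The adjoint of the inverse is a right inverse of the adjoint; so \<open>S\<close> is onto, and the
inequality of quadratic forms at all points \<open>S u\<close> is the one at all points.\<close>

lemma dyad_le_congruence_iff:
  fixes T :: "'a :: complex_hilbert \<Rightarrow> 'a"
  assumes TS: "adjoint_pair T S" and T: "invertible_op T"
  shows "dyad (T x) \<preceq> congruence T S A \<longleftrightarrow> dyad x \<preceq> A"
proof -
  have "\<exists>u. S u = v" for v
  proof -
    have "bounded_linear (inv T)" using T by (simp add: invertible_op_def)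
    then obtain R where R: "\<And>x y. inner (inv T x) y = inner x (R y)"
      using bounded_linear_adjoint_exists by blast
    have "inner x (S (R v)) = inner x v" for x
    proof -
      have "inner x (S (R v)) = inner (inv T (T x)) v"
        using TS by (simp add: R adjoint_pair_def)
      also have "inv T (T x) = x" using T by (simp add: invertible_op_def bij_is_inj)
      finally show ?thesis .
    qed
    then show ?thesis by (metis vector_eq_ldot)
  qed
  then have surj: "surj S" by (metis surjI)
  have "dyad (T x) \<preceq> congruence T S A \<longleftrightarrow> (\<forall>u. (cmod (cinner (S u) x))\<^sup>2 \<le> inner (A (S u)) (S u))"
    by (simp only: qle_def dyad_form congruence_form[OF TS] adjoint_pair_cinner[OF TS])
  also have "\<dots> \<longleftrightarrow> (\<forall>v. (cmod (cinner v x))\<^sup>2 \<le> inner (A v) v)"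
  proof (intro iffI allI)
    fix v assume S: "\<forall>u. (cmod (cinner (S u) x))\<^sup>2 \<le> inner (A (S u)) (S u)"
    obtain u where "v = S u" using surj by (rule surjE)
    then show "(cmod (cinner v x))\<^sup>2 \<le> inner (A v) v" using S by simp
  qed blast
  finally show ?thesis by (simp only: qle_def dyad_form)
qed

section \<open>From positive operators to all operators\<close>

text \<open>Both \<open>\<phi> A\<close> and \<open>T A T\<^sup>*\<close> dominate \<open>dyad (T x)\<close> precisely if \<open>A\<close> dominates \<open>dyad x\<close>. As \<open>T\<close> is onto,
they have the same operators of rank one below them, and these determine a positive operator.\<close>

lemma congruence_on_positive:
  fixes \<phi> :: "('a :: complex_hilbert \<Rightarrow>\<^sub>L 'a) \<Rightarrow> ('a \<Rightarrow>\<^sub>L 'a)"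
  assumes "zero_preserving_order_automorphism \<phi>"
  obtains T S where "invertible_op T" "adjoint_pair T S"
    "\<And>A. A \<in> hermitian \<Longrightarrow> 0 \<preceq> A \<Longrightarrow> \<phi> A = congruence T S A"
proof -
  interpret zero_preserving_order_automorphism \<phi> by fact
  obtain T :: "'a \<Rightarrow> 'a" where T: "invertible_op T" "bounded_clinear T \<or> bounded_antilinear T"
    and dyads: "\<And>x. \<phi> (dyad x) = dyad (T x)"
    using implementing_operator by blast
  obtain S where TS: "adjoint_pair T S" using adjoint_pair_exists[OF T(2)] by blast
  have "\<phi> A = congruence T S A" if A: "A \<in> hermitian" "0 \<preceq> A" for A
  proof -
    let ?C = "congruence T S A"
    have C: "?C \<in> hermitian" "0 \<preceq> ?C"
      using A congruence_hermitian[OF TS] by (auto simp: qle_def congruence_form[OF TS])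
    have pos: "0 \<preceq> \<phi> A" using le_iff[of 0 A] A by simp
    have same: "dyad z \<preceq> \<phi> A \<longleftrightarrow> dyad z \<preceq> ?C" for z
    proof -
      have "surj T" using T(1) by (simp add: invertible_op_def bij_is_surj)
      then obtain x where z: "z = T x" by (rule surjE)
      have "dyad z \<preceq> \<phi> A \<longleftrightarrow> \<phi> (dyad x) \<preceq> \<phi> A" by (simp add: z dyads)
      also have "\<dots> \<longleftrightarrow> dyad x \<preceq> A" using A by (simp add: le_iff)
      also have "\<dots> \<longleftrightarrow> dyad z \<preceq> ?C" unfolding z by (simp add: dyad_le_congruence_iff[OF TS T(1)])
      finally show ?thesis .
    qed
    have "\<phi> A \<preceq> ?C"
      using same by (intro positive_le_if_dyads_le[OF closed[OF A(1)] pos C(2)]) simp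
    moreover have "?C \<preceq> \<phi> A"
      using same by (intro positive_le_if_dyads_le[OF C pos]) simp
    ultimately show ?thesis by (intro qle_antisym closed A C)
  qed
  with T(1) TS show ?thesis using that by blast
qed

lemma qle_norm_id: "A \<preceq> norm A *\<^sub>R id_blinfun"
  unfolding qle_def
proof
  fix x
  have "inner (A x) x \<le> norm (A x) * norm x" by (rule norm_cauchy_schwarz)
  also have "\<dots> \<le> norm A * norm x * norm x" by (intro mult_right_mono norm_blinfun) auto
  finally show "inner (A x) x \<le> inner ((norm A *\<^sub>R id_blinfun) x) x"
    by (simp add: blinfun.scaleR_left power2_norm_eq_inner[symmetric] power2_eq_square mult.assoc)
qed

text \<open>In infinite dimensions an arbitrary self-adjoint operator need not dominate any operator of
finite rank, so the values of \<open>\<phi>\<close> at such operators are reached by moving the base point. The map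
\<open>C \<mapsto> \<phi> (B + C) - \<phi> B\<close> is again an order automorphism and thus a congruence on positive \<open>C\<close>.
For \<open>B = 0\<close> and \<open>B = - \<parallel>A\<parallel>\<close> the two congruences agree on the positive operators, hence on all
differences of such, and the second one controls \<open>\<phi> A\<close>.\<close>

lemma affine_form:
  fixes \<phi> :: "('a :: complex_hilbert \<Rightarrow>\<^sub>L 'a) \<Rightarrow> ('a \<Rightarrow>\<^sub>L 'a)"
  assumes "order_automorphism_dim_ge_2 \<phi>"
  obtains T S where "invertible_op T" "adjoint_pair T S"
    "\<And>A. A \<in> hermitian \<Longrightarrow> \<phi> A = congruence T S A + \<phi> 0"
proof -
  interpret order_automorphism_dim_ge_2 \<phi> by fact
  have cone: "\<exists>T S. invertible_op T \<and> adjoint_pair T S \<and>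
      (\<forall>C. C \<in> hermitian \<longrightarrow> 0 \<preceq> C \<longrightarrow> \<phi> (B + C) = \<phi> B + congruence T S C)"
    if B: "B \<in> hermitian" for B
  proof -
    interpret t: order_automorphism "\<lambda>C. \<phi> (B + C) - \<phi> B" by (rule translate[OF B])
    interpret t: zero_preserving_order_automorphism "\<lambda>C. \<phi> (B + C) - \<phi> B"
      by unfold_locales (simp_all add: not_line)
    obtain T S where TS: "invertible_op T" "adjoint_pair T S"
      and eq: "\<And>C. C \<in> hermitian \<Longrightarrow> 0 \<preceq> C \<Longrightarrow> \<phi> (B + C) - \<phi> B = congruence T S C"
      using congruence_on_positive[OF t.zero_preserving_order_automorphism_axioms] by blast
    have "\<phi> (B + C) = \<phi> B + congruence T S C" if "C \<in> hermitian" "0 \<preceq> C" for C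
      using eq[OF that] by (simp add: algebra_simps)
    with TS show ?thesis by blast
  qed
  from cone[of 0] obtain T S where TS: "invertible_op T" "adjoint_pair T S"
    and pos: "\<And>C. C \<in> hermitian \<Longrightarrow> 0 \<preceq> C \<Longrightarrow> \<phi> C = \<phi> 0 + congruence T S C"
    by auto
  have "\<phi> A = congruence T S A + \<phi> 0" if A: "A \<in> hermitian" for A
  proof -
    (* the base point -I lies below both 0 and A *)
    define I where "I = norm A *\<^sub>R (id_blinfun :: 'a \<Rightarrow>\<^sub>L 'a)"
    have I: "I \<in> hermitian" by (simp add: I_def)
    have I0: "0 \<preceq> I" by (simp add: I_def qle_def blinfun.scaleR_left)
    have AI: "0 \<preceq> A + I"
      unfolding qle_def
    proof
      show "inner (blinfun_apply 0 x) x \<le> inner ((A + I) x) x" for x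
        using qle_norm_id[of "- A", unfolded qle_def, rule_format, of x]
        by (simp add: I_def blinfun.bilinear_simps inner_simps)
    qed
    have "- I \<in> hermitian" using hermitian_diff[of 0 I] I by simp
    from cone[OF this] obtain R Q
      where low: "\<And>C. C \<in> hermitian \<Longrightarrow> 0 \<preceq> C \<Longrightarrow> \<phi> (- I + C) = \<phi> (- I) + congruence R Q C"
      by blast
    have shift: "\<phi> D = \<phi> 0 + congruence R Q D" if D: "D \<in> hermitian" "0 \<preceq> D + I" for D
      using low[of "D + I"] low[of I] D I I0 by (simp add: congruence_add)
    have agree: "congruence R Q D = congruence T S D" if "D \<in> hermitian" "0 \<preceq> D" for D
    proof -
      have "0 \<preceq> D + I" using that(2) I0 qle_add_same1 qle_trans by blast
      then show ?thesis using shift[of D] pos[of D] that by simp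
    qed
    have "congruence R Q A + congruence R Q I = congruence T S A + congruence T S I"
      using agree[of "A + I"] A I AI by (simp add: congruence_add)
    then have "congruence R Q A = congruence T S A" using agree[OF I I0] by simp
    then show ?thesis using shift[OF A AI] by simp
  qed
  with TS show ?thesis using that by blast
qed

lemma exists_off_cline_if_cdim_gt_1:
  assumes "cdim TYPE('a :: complex_inner) > 1"
  shows "\<exists>w :: 'a. w \<notin> cline x"
proof (rule ccontr)
  assume "\<not> ?thesis"
  then have span: "cline x = UNIV" by auto
  then have "cdim TYPE('a) = enat (complex_vector.dim (UNIV :: 'a set))"
    unfolding cdim_def by (metis finite.emptyI finite.insertI)
  moreover have "complex_vector.dim (UNIV :: 'a set) \<le> card {x}"
    using span by (intro complex_vector.dim_le_card) auto
  ultimately have "cdim TYPE('a) \<le> 1" by (simp add: one_enat_def)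
  then show False using assms by simp
qed

theorem theorem2:
  fixes \<phi> :: "('a :: complex_hilbert \<Rightarrow> 'a) \<Rightarrow> ('a \<Rightarrow> 'a)"
  assumes "cdim TYPE('a) > 1"
    and "bij_betw \<phi> selfadjoint_ops selfadjoint_ops"
    and "\<And>A B. A \<in> selfadjoint_ops \<Longrightarrow> B \<in> selfadjoint_ops \<Longrightarrow> op_le A B \<longleftrightarrow> op_le (\<phi> A) (\<phi> B)"
  shows "\<exists>X \<in> selfadjoint_ops. \<exists>T. invertible_op T \<and>
    ((bounded_clinear T \<and>
        (\<forall>A \<in> selfadjoint_ops. \<phi> A = (\<lambda>x. T (A (cadjoint T x)) + X x))) \<or>
     (bounded_antilinear T \<and>
        (\<forall>A \<in> selfadjoint_ops. \<phi> A = (\<lambda>x. T (A (antilinear_adjoint T x)) + X x))))"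
proof -
  have sa: "blinfun_apply ` hermitian = (selfadjoint_ops :: ('a \<Rightarrow> 'a) set)"
    using selfadjoint_ops_iff by auto
  have coe: "bij_betw blinfun_apply hermitian (selfadjoint_ops :: ('a \<Rightarrow> 'a) set)"
    unfolding bij_betw_def sa by (auto intro: inj_onI simp: blinfun_apply_inject)
  have coe_inv: "bij_betw Blinfun (selfadjoint_ops :: ('a \<Rightarrow> 'a) set) hermitian"
    by (rule bij_betw_byWitness[where f' = blinfun_apply])
      (auto simp: sa[symmetric] blinfun_apply_inverse bounded_linear_Blinfun_apply
        blinfun.bounded_linear_right)
  define \<psi> where "\<psi> A = Blinfun (\<phi> (blinfun_apply A))" for A :: "'a \<Rightarrow>\<^sub>L 'a"
  have \<psi>: "blinfun_apply (\<psi> A) = \<phi> (blinfun_apply A)" if "A \<in> hermitian" for A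
  proof -
    have "\<phi> (blinfun_apply A) \<in> selfadjoint_ops"
      using bij_betwE[OF assms(2)] that sa by blast
    then obtain B where "\<phi> (blinfun_apply A) = blinfun_apply B" using sa by blast
    then show ?thesis by (simp add: \<psi>_def blinfun_apply_inverse)
  qed
  have "order_automorphism_dim_ge_2 \<psi>"
  proof
    have "bij_betw (Blinfun \<circ> (\<phi> \<circ> blinfun_apply)) hermitian hermitian"
      by (intro bij_betw_trans[OF bij_betw_trans[OF coe assms(2)] coe_inv])
    then show "bij_betw \<psi> hermitian hermitian" by (simp add: \<psi>_def[abs_def] o_def)
    show "\<psi> A \<preceq> \<psi> B \<longleftrightarrow> A \<preceq> B" if "A \<in> hermitian" "B \<in> hermitian" for A B
    proof -
      have "blinfun_apply A \<in> selfadjoint_ops" "blinfun_apply B \<in> selfadjoint_ops"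
        using that sa by blast+
      from assms(3)[OF this] show ?thesis by (simp only: \<psi>[OF that(1)] \<psi>[OF that(2)] flip: op_le_iff_qle)
    qed
    show "\<exists>w :: 'a. w \<notin> cline x" for x by (rule exists_off_cline_if_cdim_gt_1[OF assms(1)])
  qed
  then obtain T S where T: "invertible_op T" and TS: "adjoint_pair T S"
    and form: "\<And>A. A \<in> hermitian \<Longrightarrow> \<psi> A = congruence T S A + \<psi> 0"
    using affine_form by blast
  let ?X = "blinfun_apply (\<psi> 0)"
  have X: "?X \<in> selfadjoint_ops"
    using bij_betwE[OF assms(2)] sa hermitian_0 \<psi>[OF hermitian_0] by (metis imageI)
  have "\<forall>A \<in> selfadjoint_ops. \<phi> A = (\<lambda>x. T (A (S x)) + ?X x)"
  proof
    fix A :: "'a \<Rightarrow> 'a" assume A: "A \<in> selfadjoint_ops"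
    obtain B where B: "B \<in> hermitian" "A = blinfun_apply B" using A selfadjoint_ops_iff by blast
    have "\<phi> A = blinfun_apply (congruence T S B + \<psi> 0)"
      using B \<psi> form by metis
    then show "\<phi> A = (\<lambda>x. T (A (S x)) + ?X x)"
      by (auto simp: B(2) blinfun.add_left congruence_apply[OF TS])
  qed
  moreover have "bounded_clinear T \<and> cadjoint T = S \<or> bounded_antilinear T \<and> antilinear_adjoint T = S"
    using TS by (auto simp: adjoint_pair_def)
  ultimately show ?thesis using T by (intro bexI[OF _ X] exI[of _ T] conjI) blast+
qed

end
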